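(* Let $(R,\mathfrak m,k)$ be a local Artinian ring of type two with canonical module $\omega$. Write $R=S/I$, where $S$ is a regular local ring with maximal ideal $\mathfrak m_S$, and write $I=J_1\cap J_2$, where $J_1,J_2$ are irreducible ideals of $S$. Then the following three conditions are equivalent: (1) $\mathfrak m\subseteq\omega^*(\omega)$. (2) For all ideals $K$ of $R$ generated by a system of parameters and for all ideals $\mathfrak a\supseteq K$ of $R$, $K:(K:\mathfrak a)\subseteq \mathfrak a:\mathfrak m$. (3) For all ideals $K$ of $R$ generated by a system of parameters whose members are not contained in any prime of a given finite (or countable, if $R$ is complete or $k$ is uncountable) set of primes not equal to $\mathfrak m$, and for all ideals $\mathfrak a\supseteq K$ of $R$, $K:(K:\mathfrak a)\subseteq \mathfrak a:\mathfrak m$. (Since $R$ is Artinian, $K=0$ in (2) and (3), so both say that $0:_R(0:_R\mathfrak a)\subseteq\mathfrak a:_R\mathfrak m$ for every ideal $\mathfrak a$ of $R$.) Furthermore, these conditions are also all equivalent to $$(J_1:_SJ_2)+(J_2:_SJ_1)=\mathfrak m_S .$$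
   Context: All rings are commutative and Noetherian. The type of an Artinian local ring is the $k$-dimension of its socle $0:_R\mathfrak m$. For an $R$-module $M$, $M^*=\operatorname{Hom}_R(M,R)$, and $M^*(M)$ is the ideal of $R$ generated by all elements $f(x)$ with $x\in M$, $f\in M^*$. For $R$ Artinian local, the canonical module $\omega$ is the injective hull of $k$. An ideal is irreducible if it is proper and not an intersection of two strictly larger ideals. *)

theory Defs
  imports
    "HOL-Algebra.Ring_Divisibility"
    "HOL-Algebra.Ideal_Product"
    "HOL-Library.Countable_Set"
    "HOL-Library.Extended_Nat"
    "Jordan_Normal_Form.Missing_VectorSpace"
begin

section \<open>Local rings\<close>

locale local_ring = cring R for R (structure) and \<mm> +
  assumes maximal: "maximalideal \<mm> R"
    and unique_maximal: "maximalideal J R \<Longrightarrow> J = \<mm>"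

locale noetherian_local_ring = local_ring R \<mm> + noetherian_ring R for R (structure) and \<mm>

definition artinian_ring :: "('a, 'c) ring_scheme \<Rightarrow> bool" where
  "artinian_ring R \<longleftrightarrow> ring R \<and>
     (\<forall>I :: nat \<Rightarrow> 'a set. (\<forall>n. ideal (I n) R \<and> I (Suc n) \<subseteq> I n) \<longrightarrow> (\<exists>N. \<forall>n\<ge>N. I n = I N))"

text \<open>The supremum of the lengths \<open>n\<close> of chains \<open>P 0 \<subset> \<dots> \<subset> P n\<close> of prime ideals.\<close>

definition krull_dim :: "('a, 'c) ring_scheme \<Rightarrow> enat" where
  "krull_dim R =
     (SUP n \<in> {n. \<exists>P :: nat \<Rightarrow> 'a set. (\<forall>i\<le>n. primeideal (P i) R) \<and> (\<forall>i<n. P i \<subset> P (Suc i))}. enat n)"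

text \<open>The minimal number of generators of the maximal ideal of a Noetherian local ring.\<close>

definition embedding_dim :: "('a, 'c) ring_scheme \<Rightarrow> 'a set \<Rightarrow> nat" where
  "embedding_dim R \<mm> = (LEAST n. \<exists>A. A \<subseteq> carrier R \<and> finite A \<and> card A = n \<and> \<mm> = Idl\<^bsub>R\<^esub> A)"

definition regular_local_ring :: "('a, 'c) ring_scheme \<Rightarrow> 'a set \<Rightarrow> bool" where
  "regular_local_ring R \<mm> \<longleftrightarrow> noetherian_local_ring R \<mm> \<and> enat (embedding_dim R \<mm>) = krull_dim R"

text \<open>Bijectivity of the canonical map from \<open>R\<close> to the inverse limit of the rings \<open>R/\<mm>\<^sup>n\<close>:
  every compatible family of residue classes (given by representatives \<open>x n\<close>) comes from exactly
  one element. The powers of \<open>\<mm>\<close> are taken in the monoid of ideals.\<close>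

definition adically_complete :: "('a, 'c) ring_scheme \<Rightarrow> 'a set \<Rightarrow> bool" where
  "adically_complete R \<mm> \<longleftrightarrow>
     (\<forall>x :: nat \<Rightarrow> 'a.
        (\<forall>n. x n \<in> carrier R \<and> x (Suc n) \<ominus>\<^bsub>R\<^esub> x n \<in> \<mm> [^]\<^bsub>ideals_set R\<^esub> n) \<longrightarrow>
        (\<exists>!y. y \<in> carrier R \<and> (\<forall>n. y \<ominus>\<^bsub>R\<^esub> x n \<in> \<mm> [^]\<^bsub>ideals_set R\<^esub> n)))"


section \<open>Ideals\<close>

definition ideal_colon :: "('a, 'c) ring_scheme \<Rightarrow> 'a set \<Rightarrow> 'a set \<Rightarrow> 'a set" where
  "ideal_colon R J K = {r \<in> carrier R. \<forall>x\<in>K. r \<otimes>\<^bsub>R\<^esub> x \<in> J}"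

definition radical_ideal :: "('a, 'c) ring_scheme \<Rightarrow> 'a set \<Rightarrow> 'a set" where
  "radical_ideal R J = {r \<in> carrier R. \<exists>n::nat. r [^]\<^bsub>R\<^esub> n \<in> J}"

definition irreducible_ideal :: "('a, 'c) ring_scheme \<Rightarrow> 'a set \<Rightarrow> bool" where
  "irreducible_ideal R J \<longleftrightarrow> ideal J R \<and> J \<noteq> carrier R \<and>
     \<not> (\<exists>A B. ideal A R \<and> ideal B R \<and> J \<subset> A \<and> J \<subset> B \<and> J = A \<inter> B)"

text \<open>In a local ring with maximal ideal \<open>\<mm>\<close>: \<open>dim R\<close> elements of \<open>\<mm>\<close> generating an
  \<open>\<mm>\<close>-primary ideal, i.e. one with radical \<open>\<mm>\<close>. In dimension 0 this is the empty list.\<close>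

definition system_of_parameters :: "('a, 'c) ring_scheme \<Rightarrow> 'a set \<Rightarrow> 'a list \<Rightarrow> bool" where
  "system_of_parameters R \<mm> xs \<longleftrightarrow>
     set xs \<subseteq> \<mm> \<and> enat (length xs) = krull_dim R \<and> radical_ideal R (Idl\<^bsub>R\<^esub> (set xs)) = \<mm>"


section \<open>The type of a local ring\<close>

text \<open>The socle \<open>0 :\<^sub>R \<mm>\<close> as a vector space over the residue field. A residue class acts through any
  representative; the result does not depend on the choice, as \<open>\<mm>\<close> annihilates the socle.\<close>

definition socle_space :: "('a, 'c) ring_scheme \<Rightarrow> 'a set \<Rightarrow> ('a set, 'a) module" where
  "socle_space R \<mm> =
     \<lparr>carrier = ideal_colon R {\<zero>\<^bsub>R\<^esub>} \<mm>, mult = mult R, one = \<one>\<^bsub>R\<^esub>, zero = \<zero>\<^bsub>R\<^esub>, add = add R,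
      smult = (\<lambda>X x. (SOME r. r \<in> X) \<otimes>\<^bsub>R\<^esub> x)\<rparr>"

definition local_ring_type :: "('a, 'c) ring_scheme \<Rightarrow> 'a set \<Rightarrow> nat" where
  "local_ring_type R \<mm> = vectorspace.dim (R Quot \<mm>) (socle_space R \<mm>)"


section \<open>Modules\<close>

text \<open>In the two modules below the fields \<open>mult\<close> and \<open>one\<close> are irrelevant.\<close>

definition self_module :: "('a, 'c) ring_scheme \<Rightarrow> ('a, 'a) module" where
  "self_module R =
     \<lparr>carrier = carrier R, mult = mult R, one = \<one>\<^bsub>R\<^esub>, zero = \<zero>\<^bsub>R\<^esub>, add = add R, smult = mult R\<rparr>"

definition quotient_module :: "('a, 'c) ring_scheme \<Rightarrow> 'a set \<Rightarrow> ('a, 'a set) module" where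
  "quotient_module R J =
     \<lparr>carrier = carrier (R Quot J), mult = mult (R Quot J), one = \<one>\<^bsub>R Quot J\<^esub>,
      zero = \<zero>\<^bsub>R Quot J\<^esub>, add = add (R Quot J),
      smult = (\<lambda>r X. (J +>\<^bsub>R\<^esub> r) \<otimes>\<^bsub>R Quot J\<^esub> X)\<rparr>"

definition module_dual :: "('a, 'c) ring_scheme \<Rightarrow> ('a, 'b, 'd) module_scheme \<Rightarrow> ('b \<Rightarrow> 'a) set" where
  "module_dual R M = module_hom R M (self_module R)"

text \<open>The ideal \<open>M\<^sup>*(M)\<close>.\<close>

definition trace_ideal :: "('a, 'c) ring_scheme \<Rightarrow> ('a, 'b, 'd) module_scheme \<Rightarrow> 'a set" where
  "trace_ideal R M = Idl\<^bsub>R\<^esub> {f x | f x. f \<in> module_dual R M \<and> x \<in> carrier M}"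

text \<open>HOL cannot quantify over modules with carriers in all types, so the test modules \<open>A\<close>, \<open>B\<close> range
  over the \<open>R\<close>-modules whose carrier lies in the element type of \<open>R\<close>. This is no restriction: these
  include \<open>R\<close> and its ideals, to which Baer's criterion reduces injectivity in general.\<close>

definition injective_module :: "('a, 'c) ring_scheme \<Rightarrow> ('a, 'b, 'd) module_scheme \<Rightarrow> bool" where
  "injective_module R E \<longleftrightarrow> module R E \<and>
     (\<forall>(A :: ('a, 'a) module) (B :: ('a, 'a) module) f g.
        module R A \<and> module R B \<and>
        f \<in> module_hom R A B \<and> inj_on f (carrier A) \<and> g \<in> module_hom R A E \<longrightarrow>
        (\<exists>h \<in> module_hom R B E. \<forall>x \<in> carrier A. h (f x) = g x))"

definition injective_hull ::
  "('a, 'c) ring_scheme \<Rightarrow> ('a, 'b, 'd) module_scheme \<Rightarrow> ('a, 'w, 'e) module_scheme \<Rightarrow> bool" where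
  "injective_hull R M E \<longleftrightarrow> injective_module R E \<and>
     (\<exists>\<iota> \<in> module_hom R M E. inj_on \<iota> (carrier M) \<and>
        (\<forall>N. submodule R N E \<and> N \<noteq> {\<zero>\<^bsub>E\<^esub>} \<longrightarrow> N \<inter> \<iota> ` carrier M \<noteq> {\<zero>\<^bsub>E\<^esub>}))"

text \<open>For an Artinian local ring: the injective hull of the residue field.\<close>

definition canonical_module ::
  "('a, 'c) ring_scheme \<Rightarrow> 'a set \<Rightarrow> ('a, 'w, 'd) module_scheme \<Rightarrow> bool" where
  "canonical_module R \<mm> W \<longleftrightarrow> injective_hull R (quotient_module R \<mm>) W"

end

theory Submission
  imports Defs
begin

text \<open>
  Let \<open>q\<^sub>1, q\<^sub>2\<close> be the images of \<open>J\<^sub>1, J\<^sub>2\<close> in \<open>R\<close>, so that \<open>q\<^sub>1 \<inter> q\<^sub>2 = 0\<close>, and let \<open>b\<^sub>i = 0 : q\<^sub>i\<close>; then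
  \<open>q\<^sub>1 : q\<^sub>2 = b\<^sub>2\<close> and \<open>q\<^sub>2 : q\<^sub>1 = b\<^sub>1\<close>. By Matlis duality \<open>\<omega> = Rw\<^sub>1 + Rw\<^sub>2\<close> with \<open>ann w\<^sub>i = q\<^sub>i\<close>.

  The trace ideal is exactly \<open>b\<^sub>1 + b\<^sub>2\<close>. It is contained in the sum because \<open>q\<^sub>i f(w\<^sub>i) = 0\<close>. Conversely,
  for \<open>r \<in> b\<^sub>1\<close> duality gives \<open>r w\<^sub>2 = a w\<^sub>1\<close>, and \<open>w\<^sub>1 \<mapsto> r, w\<^sub>2 \<mapsto> a\<close> extends to \<open>\<omega>\<close>: if \<open>s w\<^sub>1 + t w\<^sub>2 = 0\<close>,
  then \<open>s r + t a\<close> kills both \<open>w\<^sub>1\<close> and \<open>w\<^sub>2\<close>. Type two makes \<open>q\<^sub>1, q\<^sub>2\<close> nonzero, hence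
  \<open>b\<^sub>1 + b\<^sub>2 \<subseteq> \<mm>\<close>.

  If \<open>\<mm>\<close> lies in the trace ideal and \<open>y \<in> 0 : (0 : \<aa>)\<close>, then \<open>y \<omega> \<subseteq> \<aa> \<omega>\<close> by duality, so
  \<open>y f(x) = f(y x) \<in> \<aa>\<close>. Conversely, condition (2) is only needed for \<open>\<aa> = q\<^sub>1\<close>: every \<open>y\<close> that kills
  \<open>(b\<^sub>1 + b\<^sub>2) w\<^sub>1\<close> lies in \<open>0 : b\<^sub>1\<close>, hence kills \<open>\<mm> w\<^sub>1\<close>, and duality gives \<open>\<mm> w\<^sub>1 \<subseteq> (b\<^sub>1 + b\<^sub>2) w\<^sub>1\<close>.
\<close>

section \<open>Ideals\<close>

lemma ideal_colonI:
  assumes "r \<in> carrier R" "\<And>x. x \<in> K \<Longrightarrow> r \<otimes>\<^bsub>R\<^esub> x \<in> J"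
  shows "r \<in> ideal_colon R J K"
  using assms by (simp add: ideal_colon_def)

lemma ideal_colonD:
  assumes "r \<in> ideal_colon R J K"
  shows "r \<in> carrier R" "x \<in> K \<Longrightarrow> r \<otimes>\<^bsub>R\<^esub> x \<in> J"
  using assms by (simp_all add: ideal_colon_def)

section \<open>Elementary ideal arithmetic: colons, sums and adjoining one element\<close>

context cring
begin

text \<open>Negatives come for free as multiples by \<open>\<ominus> \<one>\<close>, and
  commutativity turns left absorption into right absorption.\<close>

lemma ideal_of_closed:
  assumes "I \<subseteq> carrier R" "\<zero> \<in> I"
    and "\<And>a b. a \<in> I \<Longrightarrow> b \<in> I \<Longrightarrow> a \<oplus> b \<in> I"
    and smult: "\<And>r a. r \<in> carrier R \<Longrightarrow> a \<in> I \<Longrightarrow> r \<otimes> a \<in> I"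
  shows "ideal I R"
proof (intro idealI subgroup.intro)
  show "ring R" by (rule ring_axioms)
  fix a assume a: "a \<in> I"
  then have "\<ominus> \<one> \<otimes> a \<in> I" by (intro smult) auto
  moreover have "\<ominus> \<one> \<otimes> a = \<ominus> a" using a assms(1) by (auto simp: l_minus)
  ultimately show "inv\<^bsub>add_monoid R\<^esub> a \<in> I" by (simp add: a_inv_def)
next
  fix a x assume a: "a \<in> I" "x \<in> carrier R"
  then show "a \<otimes> x \<in> I" using smult[of x a] assms(1) by (simp add: m_comm subset_iff)
qed (use assms in auto)

lemma ideal_colon_ideal:
  assumes "ideal J R" "K \<subseteq> carrier R"
  shows "ideal (ideal_colon R J K) R"
proof -
  interpret J: ideal J R by fact
  show ?thesis
  proof (rule ideal_of_closed)
    fix r a assume ra: "r \<in> carrier R" "a \<in> ideal_colon R J K"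
    have "r \<otimes> a \<otimes> x \<in> J" if "x \<in> K" for x
      using ra that assms(2) J.I_l_closed[of "a \<otimes> x" r]
      by (auto simp: ideal_colon_def m_assoc subset_iff)
    then show "r \<otimes> a \<in> ideal_colon R J K"
      using ra by (auto simp: ideal_colon_def)
  qed (use assms(2) in \<open>auto simp: ideal_colon_def l_distr subset_iff\<close>)
qed

lemma ideal_summandR:
  assumes "ideal J R" "x \<in> J" "y \<in> carrier R" "x \<oplus> y \<in> J"
  shows "y \<in> J"
proof -
  interpret J: ideal J R by fact
  have "y = \<ominus> x \<oplus> (x \<oplus> y)"
    using assms(2,3) by (simp add: J.Icarr r_neg2 r_neg1)
  with assms(2,4) show ?thesis by (metis J.a_closed J.a_inv_closed)
qed

lemma ideal_subset_colon:
  assumes "ideal I R" "I \<subseteq> J" "K \<subseteq> carrier R"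
  shows "I \<subseteq> ideal_colon R J K"
proof (intro subsetI ideal_colonI)
  interpret I: ideal I R by fact
  fix x y assume x: "x \<in> I"
  then show "x \<in> carrier R" by (rule I.Icarr)
  assume "y \<in> K"
  then have "y \<in> carrier R" using assms(3) by blast
  with x have "x \<otimes> y \<in> I" by (rule I.I_r_closed)
  then show "x \<otimes> y \<in> J" using assms(2) by blast
qed

lemma ideal_subset_sum:
  assumes "ideal I R" "ideal J R"
  shows "I \<subseteq> I <+>\<^bsub>R\<^esub> J"
proof
  fix x assume x: "x \<in> I"
  then have "x = x \<oplus> \<zero>" using ideal.Icarr[OF assms(1)] by simp
  moreover have "\<zero> \<in> J" using assms(2) by (intro additive_subgroup.zero_closed ideal.axioms(1))
  ultimately show "x \<in> I <+>\<^bsub>R\<^esub> J" unfolding set_add_def' using x by blast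
qed

text \<open>This passes a membership from generators to the ideal they generate: once these
  \<open>x\<close> contain the generators, minimality of the generated ideal does the rest.\<close>

lemma ideal_mult_vimage:
  assumes "ideal J R" "y \<in> carrier R"
  shows "ideal {x \<in> carrier R. y \<otimes> x \<in> J} R"
proof -
  interpret J: ideal J R by fact
  show ?thesis
  proof (rule ideal_of_closed)
    fix r a assume "r \<in> carrier R" "a \<in> {x \<in> carrier R. y \<otimes> x \<in> J}"
    then show "r \<otimes> a \<in> {x \<in> carrier R. y \<otimes> x \<in> J}"
      using J.I_l_closed[of "y \<otimes> a" r] assms(2) by (simp add: m_lcomm)
  qed (use assms(2) in \<open>auto simp: r_distr\<close>)
qed

lemma add_cgenideal_iff:
  "x \<in> J <+>\<^bsub>R\<^esub> PIdl u \<longleftrightarrow> (\<exists>j\<in>J. \<exists>r\<in>carrier R. x = j \<oplus> r \<otimes> u)"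
  by (auto simp: set_add_def' cgenideal_def)

lemma add_cgenideal_strict:
  assumes "ideal J R" "u \<in> carrier R" "u \<notin> J"
  shows "ideal (J <+>\<^bsub>R\<^esub> PIdl u) R" "J \<subset> J <+>\<^bsub>R\<^esub> PIdl u" "u \<in> J <+>\<^bsub>R\<^esub> PIdl u"
proof -
  interpret J: ideal J R by fact
  show "ideal (J <+>\<^bsub>R\<^esub> PIdl u) R"
    by (intro add_ideals assms cgenideal_ideal)
  show u: "u \<in> J <+>\<^bsub>R\<^esub> PIdl u"
    unfolding add_cgenideal_iff using assms(2)
    by (intro bexI[of _ \<zero>] bexI[of _ \<one>]) auto
  have "x \<in> J <+>\<^bsub>R\<^esub> PIdl u" if "x \<in> J" for x
    unfolding add_cgenideal_iff using assms(2) that J.Icarr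
    by (intro bexI[of _ x] bexI[of _ \<zero>]) auto
  with u assms(3) show "J \<subset> J <+>\<^bsub>R\<^esub> PIdl u" by auto
qed

end

section \<open>Maximal elements and Noetherian induction\<close>

text \<open>In a Noetherian ring the union of a nonempty chain of ideals is itself a member of the
  chain, so Zorn's lemma applies to an arbitrary property \<open>Q\<close>.\<close>

lemma (in noetherian_ring) obtain_maximal_ideal:
  assumes "ideal J R" "Q J"
  obtains M where "ideal M R" "Q M" "\<And>J'. ideal J' R \<Longrightarrow> Q J' \<Longrightarrow> M \<subseteq> J' \<Longrightarrow> J' = M"
proof -
  define \<S> where "\<S> = {J. ideal J R \<and> Q J}"
  have "\<exists>M\<in>\<S>. \<forall>J'\<in>\<S>. M \<subseteq> J' \<longrightarrow> J' = M"
  proof (rule subset_Zorn_nonempty)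
    show "\<S> \<noteq> {}" using assms by (auto simp: \<S>_def)
    fix C assume C: "C \<noteq> {}" "subset.chain \<S> C"
    then have "subset.chain {I. ideal I R} C"
      by (auto simp: pred_on.chain_def \<S>_def)
    from ideal_chain_is_trivial[OF C(1) this] C(2) show "\<Union>C \<in> \<S>"
      by (auto simp: pred_on.chain_def)
  qed
  then show thesis using that unfolding \<S>_def by blast
qed

text \<open>A maximal counterexample would satisfy the induction hypothesis.\<close>

lemma (in noetherian_ring) noetherian_ideal_induct [consumes 1, case_names step]:
  assumes "ideal J R"
    and step: "\<And>J. ideal J R \<Longrightarrow> (\<And>J'. ideal J' R \<Longrightarrow> J \<subset> J' \<Longrightarrow> P J') \<Longrightarrow> P J"
  shows "P J"
proof (rule ccontr)
  assume "\<not> P J"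
  with assms(1) show False
  proof (rule obtain_maximal_ideal[where Q = "\<lambda>J. \<not> P J"])
    fix M assume M: "ideal M R" "\<not> P M"
      and max: "\<And>J'. ideal J' R \<Longrightarrow> \<not> P J' \<Longrightarrow> M \<subseteq> J' \<Longrightarrow> J' = M"
    have "P J'" if "ideal J' R" "M \<subset> J'" for J'
      using max[OF that(1)] that(2) by blast
    from step[OF M(1) this] M(2) show False by blast
  qed
qed

section \<open>Local rings\<close>

context noetherian_local_ring
begin

sublocale maximal: maximalideal \<mm> R by (rule maximal)

text \<open>An ideal that is maximal among the proper ideals containing \<open>J\<close> is a
  maximal ideal of the ring, hence equals \<open>\<mm>\<close> by uniqueness.\<close>

lemma proper_ideal_subset:
  assumes "ideal J R" "J \<noteq> carrier R"
  shows "J \<subseteq> \<mm>"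
proof -
  from assms(1) show ?thesis
  proof (rule obtain_maximal_ideal[where Q = "\<lambda>J'. J' \<noteq> carrier R \<and> J \<subseteq> J'"])
    show "J \<noteq> carrier R \<and> J \<subseteq> J" using assms(2) by simp
    fix M assume M: "ideal M R" "M \<noteq> carrier R \<and> J \<subseteq> M"
      and max: "\<And>J'. ideal J' R \<Longrightarrow> J' \<noteq> carrier R \<and> J \<subseteq> J' \<Longrightarrow> M \<subseteq> J' \<Longrightarrow> J' = M"
    have "maximalideal M R"
    proof (rule maximalidealI)
      fix J' assume "ideal J' R" "M \<subseteq> J'" "J' \<subseteq> carrier R"
      then show "J' = M \<or> J' = carrier R" using max[of J'] M(2) by auto
    qed (use M in auto)
    with M(2) unique_maximal show ?thesis by auto
  qed
qed

lemma unit_if_notin: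
  assumes "x \<in> carrier R" "x \<notin> \<mm>"
  obtains y where "y \<in> carrier R" "y \<otimes> x = \<one>"
proof -
  have "PIdl x = carrier R"
    using proper_ideal_subset[of "PIdl x"] assms cgenideal_ideal cgenideal_self by blast
  then have "\<one> \<in> PIdl x" by simp
  then show thesis using that by (auto simp: cgenideal_def)
qed

lemma one_notin: "\<one> \<notin> \<mm>"
  using maximal.I_notcarr maximal.one_imp_carrier by auto

lemma zero_neq_one: "\<zero> \<noteq> \<one>"
  using one_notin maximal.zero_closed by metis

lemma mult_unit_in_ideal:
  assumes "ideal J R" "r \<in> carrier R" "r \<notin> \<mm>" "x \<in> carrier R" "r \<otimes> x \<in> J"
  shows "x \<in> J"
proof -
  interpret J: ideal J R by fact
  obtain s where s: "s \<in> carrier R" "s \<otimes> r = \<one>"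
    using unit_if_notin assms by blast
  have "s \<otimes> (r \<otimes> x) \<in> J" using s assms by (simp add: J.I_l_closed)
  then show ?thesis using s assms by (simp flip: m_assoc)
qed

text \<open>The class of \<open>u\<close> is a socle element of \<open>R/q\<close>, and
  irreducibility makes it lie in every nonzero ideal of \<open>R/q\<close>. Indeed
  \<open>q + Ru\<close> and \<open>c\<close> share some \<open>y = j + ru\<close> outside
  \<open>q\<close>; since \<open>\<mm>\<close> sends \<open>u\<close> into \<open>q\<close>, the
  coefficient \<open>r\<close> is a unit, so \<open>u\<close> can be recovered inside
  \<open>c\<close>.\<close>

lemma irreducible_ideal_in_larger:
  assumes "irreducible_ideal R q" "u \<in> carrier R" "u \<notin> q" "\<And>z. z \<in> \<mm> \<Longrightarrow> z \<otimes> u \<in> q"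
    and "ideal c R" "q \<subset> c"
  shows "u \<in> c"
proof -
  interpret q: ideal q R using assms(1) by (simp add: irreducible_ideal_def)
  interpret c: ideal c R by fact
  have "q \<noteq> (q <+>\<^bsub>R\<^esub> PIdl u) \<inter> c"
    using assms(1,5,6) add_cgenideal_strict(1,2)[OF q.is_ideal assms(2,3)]
    by (metis irreducible_ideal_def)
  moreover have "q \<subseteq> (q <+>\<^bsub>R\<^esub> PIdl u) \<inter> c"
    using assms(6) add_cgenideal_strict(2)[OF q.is_ideal assms(2,3)] by auto
  ultimately obtain y where y: "y \<in> q <+>\<^bsub>R\<^esub> PIdl u" "y \<in> c" "y \<notin> q"
    by auto
  then obtain j r where jr: "j \<in> q" "r \<in> carrier R" "y = j \<oplus> r \<otimes> u"
    unfolding add_cgenideal_iff by auto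
  have "r \<notin> \<mm>" using jr y(3) assms(4) q.a_closed by auto
  moreover have "j \<in> c" "r \<otimes> u \<in> carrier R" using jr(1,2) assms(2,6) by auto
  then have "r \<otimes> u \<in> c"
    using ideal_summandR[OF assms(5)] y(2) jr(3) by blast
  ultimately show ?thesis using mult_unit_in_ideal[OF assms(5)] jr assms(2) by blast
qed

end

section \<open>Artinian local rings: nilpotence, socle elements and dimension zero\<close>

locale artinian_local_ring = noetherian_local_ring R \<mm> for R (structure) and \<mm> +
  assumes artinian: "artinian_ring R"
begin

text \<open>The descending chain of principal ideals \<open>(z^n)\<close> stabilises, which gives
  \<open>z^N = r z^(N+1)\<close>. Then \<open>1 - rz\<close> kills \<open>z^N\<close>, and it is a
  unit because \<open>rz\<close> lies in \<open>\<mm>\<close>.\<close>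

lemma maximal_ideal_nilpotent:
  assumes "z \<in> \<mm>"
  obtains n where "z [^] (n::nat) = \<zero>"
proof -
  have z: "z \<in> carrier R" using assms maximal.Icarr by blast
  have "PIdl (z [^] Suc n) \<subseteq> PIdl (z [^] n)" for n :: nat
  proof (rule cgenideal_minimal)
    show "ideal (PIdl (z [^] n)) R" using z by (intro cgenideal_ideal) simp
    show "z [^] Suc n \<in> PIdl (z [^] n)"
      using z unfolding cgenideal_def by (auto intro!: exI[of _ z] simp: m_comm)
  qed
  then have "ideal (PIdl (z [^] n)) R \<and> PIdl (z [^] Suc n) \<subseteq> PIdl (z [^] n)" for n :: nat
    using z cgenideal_ideal by auto
  then have "\<exists>N. \<forall>n\<ge>N. PIdl (z [^] n) = PIdl (z [^] (N::nat))"
    using artinian[unfolded artinian_ring_def, THEN conjunct2, THEN spec[of _ "\<lambda>n. PIdl (z [^] n)"]]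
    by simp
  then obtain N :: nat where "PIdl (z [^] Suc N) = PIdl (z [^] N)"
    using le_Suc_eq by blast
  then have "z [^] N \<in> PIdl (z [^] Suc N)"
    using z cgenideal_self[of "z [^] N"] by simp
  then obtain r where r: "r \<in> carrier R" "z [^] N = r \<otimes> z [^] Suc N"
    unfolding cgenideal_def by auto
  have rz: "r \<otimes> z \<in> \<mm>" using r assms maximal.I_l_closed by blast
  have "\<one> \<ominus> r \<otimes> z \<notin> \<mm>"
  proof
    assume "\<one> \<ominus> r \<otimes> z \<in> \<mm>"
    then have "(\<one> \<ominus> r \<otimes> z) \<oplus> r \<otimes> z \<in> \<mm>" using rz maximal.a_closed by blast
    moreover have "(\<one> \<ominus> r \<otimes> z) \<oplus> r \<otimes> z = \<one>"
      using r z by (simp add: minus_eq a_assoc l_neg)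
    ultimately show False using one_notin by simp
  qed
  moreover have "(\<one> \<ominus> r \<otimes> z) \<otimes> z [^] N \<in> {\<zero>}"
  proof -
    have "(\<one> \<ominus> r \<otimes> z) \<otimes> z [^] N = z [^] N \<ominus> r \<otimes> z [^] Suc N"
      using r(1) z m_comm[of z "z [^] N"] by (simp add: minus_eq l_distr l_minus m_assoc)
    also have "\<dots> = \<zero>" using r z by (metis nat_pow_closed r_right_minus_eq)
    finally show ?thesis by simp
  qed
  ultimately have "z [^] N \<in> {\<zero>}"
    using r(1) z mult_unit_in_ideal[OF zeroideal, of "\<one> \<ominus> r \<otimes> z" "z [^] N"] by simp
  with that show thesis by auto
qed

text \<open>The generators of \<open>\<mm>\<close> are treated one at a time, starting from
  \<open>u = 1\<close>. A new generator \<open>z\<close> is nilpotent, so \<open>u\<close> can be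
  multiplied by the last power of \<open>z\<close> that keeps it outside \<open>J\<close>; by
  commutativity the generators already treated still send the product into \<open>J\<close>.\<close>

lemma exists_socle_element:
  assumes J: "ideal J R" "J \<noteq> carrier R"
  obtains u where "u \<in> carrier R" "u \<notin> J" "\<And>z. z \<in> \<mm> \<Longrightarrow> z \<otimes> u \<in> J"
proof -
  interpret J: ideal J R by fact
  obtain A where A: "A \<subseteq> carrier R" "finite A" "\<mm> = Idl A"
    using finetely_gen[OF maximal.is_ideal] by blast
  have "B \<subseteq> \<mm> \<Longrightarrow> \<exists>u\<in>carrier R. u \<notin> J \<and> (\<forall>z\<in>B. z \<otimes> u \<in> J)" if "finite B" for B
    using that
  proof induction
    case empty
    have "\<one> \<notin> J" using J(2) J.one_imp_carrier by blast
    then show ?case by auto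
  next
    case (insert z B)
    then obtain u where u: "u \<in> carrier R" "u \<notin> J" "\<forall>z\<in>B. z \<otimes> u \<in> J" by auto
    have z: "z \<in> \<mm>" "z \<in> carrier R" "B \<subseteq> carrier R"
      using insert.prems maximal.Icarr by auto
    obtain n where "z [^] (n::nat) = \<zero>" using maximal_ideal_nilpotent z(1) by blast
    then have ex: "z [^] n \<otimes> u \<in> J" using u by simp
    \<comment> \<open>The exponent \<open>k\<close> is the first one that reaches \<open>J\<close>.
      It is positive because \<open>u\<close> is not in \<open>J\<close>, and its predecessor
      \<open>l\<close> gives the new element.\<close>
    define k where "k = (LEAST k::nat. z [^] k \<otimes> u \<in> J)"
    have k: "z [^] k \<otimes> u \<in> J" unfolding k_def using ex by (rule LeastI)
    have "k \<noteq> 0" using k u z by (cases k) auto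
    then obtain l where l: "k = Suc l" by (cases k) auto
    have "z [^] l \<otimes> u \<notin> J"
      using not_less_Least[of l "\<lambda>k. z [^] k \<otimes> u \<in> J"] l by (simp add: k_def)
    moreover have "z \<otimes> (z [^] l \<otimes> u) \<in> J"
      using k z u by (simp add: l m_assoc m_comm m_lcomm)
    moreover have "y \<otimes> (z [^] l \<otimes> u) \<in> J" if "y \<in> B" for y
    proof -
      have y: "y \<in> carrier R" "y \<otimes> u \<in> J" using that z u by auto
      have "y \<otimes> (z [^] l \<otimes> u) = z [^] l \<otimes> (y \<otimes> u)"
        using z u y by (simp add: m_lcomm)
      then show ?thesis using J.I_l_closed[OF y(2)] z by simp
    qed
    ultimately show ?case
      using z u by (intro bexI[of _ "z [^] l \<otimes> u"]) auto
  qed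
  from this[of A] obtain u where u: "u \<in> carrier R" "u \<notin> J" "\<forall>z\<in>A. z \<otimes> u \<in> J"
    using A genideal_self by blast
  have "ideal {z \<in> carrier R. u \<otimes> z \<in> J} R"
    using J(1) u(1) by (rule ideal_mult_vimage)
  then have "\<mm> \<subseteq> {z \<in> carrier R. u \<otimes> z \<in> J}"
    unfolding A(3)
  proof (rule genideal_minimal)
    show "A \<subseteq> {z \<in> carrier R. u \<otimes> z \<in> J}"
    proof
      fix z assume "z \<in> A"
      then have "z \<in> carrier R" "z \<otimes> u \<in> J" using A(1) u(3) by auto
      then show "z \<in> {z \<in> carrier R. u \<otimes> z \<in> J}" using u(1) by (simp add: m_comm)
    qed
  qed
  then have "z \<otimes> u \<in> J" if "z \<in> \<mm>" for z
    using that u(1) maximal.Icarr[OF that] by (auto simp: m_comm)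
  with that u show thesis by auto
qed

text \<open>A prime ideal contains every nilpotent element, hence all of
  \<open>\<mm>\<close>.\<close>

lemma primeideal_eq_maximal:
  assumes "primeideal p R"
  shows "p = \<mm>"
proof
  interpret p: primeideal p R by fact
  show "p \<subseteq> \<mm>" using p.is_ideal p.I_notcarr proper_ideal_subset by blast
  show "\<mm> \<subseteq> p"
  proof
    fix z assume z: "z \<in> \<mm>"
    then obtain n where n: "z [^] (n::nat) = \<zero>" using maximal_ideal_nilpotent by blast
    have "z [^] k \<in> p \<Longrightarrow> z \<in> p" for k :: nat
    proof (induction k)
      case 0
      then show ?case using p.one_imp_carrier p.I_notcarr by auto
    next
      case (Suc k)
      then show ?case using p.I_prime[of "z [^] k" z] z maximal.Icarr by auto
    qed
    from this[of n] n show "z \<in> p" by simp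
  qed
qed

lemma krull_dim_eq_0: "krull_dim R = 0"
proof -
  have "n = 0" if "\<forall>i\<le>n. primeideal (P i) R" "\<forall>i<n. P i \<subset> P (Suc i)" for n :: nat and P
  proof (rule ccontr)
    assume "n \<noteq> 0"
    then have "P 0 \<subset> P 1" "P 0 = \<mm>" "P 1 = \<mm>"
      using that primeideal_eq_maximal by auto
    then show False by simp
  qed
  then have "{n. \<exists>P :: nat \<Rightarrow> 'a set. (\<forall>i\<le>n. primeideal (P i) R) \<and> (\<forall>i<n. P i \<subset> P (Suc i))} \<subseteq> {0}"
    by blast
  then have "krull_dim R \<le> (SUP n\<in>{0::nat}. enat n)"
    unfolding krull_dim_def by (rule SUP_subset_mono) simp
  then show ?thesis by (simp flip: zero_enat_def)
qed

lemma Idl_empty: "Idl {} = {\<zero>}"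
  using genideal_minimal[OF zeroideal, of "{}"] genideal_ideal[of "{}"]
  by (auto simp: additive_subgroup.zero_closed[OF ideal.axioms(1)])

lemma radical_zero: "radical_ideal R {\<zero>} = \<mm>"
proof -
  have "r \<in> \<mm>" if r: "r \<in> carrier R" "r [^] n = \<zero>" for r and n :: nat
  proof (rule ccontr)
    assume "r \<notin> \<mm>"
    with r(1) obtain s where s: "s \<in> carrier R" "s \<otimes> r = \<one>" by (rule unit_if_notin)
    have "\<one> = (s \<otimes> r) [^] n" using s(2) by simp
    also have "\<dots> = s [^] n \<otimes> r [^] n" using s(1) r(1) by (rule nat_pow_distrib)
    also have "\<dots> = \<zero>" using s(1) r(2) by simp
    finally show False using zero_neq_one by simp
  qed
  moreover have "r \<in> radical_ideal R {\<zero>}" if r: "r \<in> \<mm>" for r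
  proof -
    obtain n where "r [^] (n::nat) = \<zero>" using maximal_ideal_nilpotent[OF r] .
    then show ?thesis using maximal.Icarr[OF r] by (auto simp: radical_ideal_def)
  qed
  ultimately show ?thesis by (auto simp: radical_ideal_def)
qed

text \<open>Dimension zero forces the list to be empty, and the empty list qualifies because the
  radical of the zero ideal is \<open>\<mm>\<close>. This is what reduces both parameter conditions
  to \<open>K = 0\<close>.\<close>

lemma system_of_parameters_iff: "system_of_parameters R \<mm> xs \<longleftrightarrow> xs = []"
  by (auto simp: system_of_parameters_def krull_dim_eq_0 Idl_empty radical_zero zero_enat_def)

end

section \<open>Matlis duality\<close>

locale artinian_canonical = R?: artinian_local_ring R \<mm> + M?: module R M
  for R :: "('a, 'c) ring_scheme" (structure) and \<mm> and M :: "('a, 'w, 'd) module_scheme" +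
  assumes canonical: "canonical_module R \<mm> M"
begin

lemma submodule_of_closed:
  assumes "N \<subseteq> carrier M" "\<zero>\<^bsub>M\<^esub> \<in> N"
    and "\<And>x y. x \<in> N \<Longrightarrow> y \<in> N \<Longrightarrow> x \<oplus>\<^bsub>M\<^esub> y \<in> N"
    and "\<And>c x. c \<in> carrier R \<Longrightarrow> x \<in> N \<Longrightarrow> c \<odot>\<^bsub>M\<^esub> x \<in> N"
  shows "submodule R N M"
  using assms M.module_axioms by (intro submodule.intro) auto

lemma submodule_summandL:
  assumes "submodule R K M" "a \<in> carrier M" "b \<in> K" "a \<oplus>\<^bsub>M\<^esub> b \<in> K"
  shows "a \<in> K"
proof -
  interpret K: submodule R K M by fact
  have b: "b \<in> carrier M" using assms(3) K.subset by auto
  have "a = (a \<oplus>\<^bsub>M\<^esub> b) \<oplus>\<^bsub>M\<^esub> (\<ominus> \<one>) \<odot>\<^bsub>M\<^esub> b"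
    using assms(2) b by (simp add: M.smult_l_minus M.a_assoc M.r_neg)
  also have "\<dots> \<in> K" using assms(3,4) K.m_closed[OF assms(4) K.smult_closed[of "\<ominus> \<one>" b]] by simp
  finally show ?thesis .
qed

lemma smult_comm:
  assumes "c \<in> carrier R" "d \<in> carrier R" "x \<in> carrier M"
  shows "c \<odot>\<^bsub>M\<^esub> (d \<odot>\<^bsub>M\<^esub> x) = d \<odot>\<^bsub>M\<^esub> (c \<odot>\<^bsub>M\<^esub> x)"
  using assms by (metis M.smult_assoc1 R.m_comm)

lemma multiples_submodule:
  assumes "ideal B R" "w \<in> carrier M"
  shows "submodule R ((\<lambda>t. t \<odot>\<^bsub>M\<^esub> w) ` B) M"
proof -
  interpret B: ideal B R by fact
  show ?thesis
  proof (rule submodule_of_closed)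
    show "\<zero>\<^bsub>M\<^esub> \<in> (\<lambda>t. t \<odot>\<^bsub>M\<^esub> w) ` B"
      using assms(2) B.zero_closed by (intro image_eqI[of _ _ \<zero>]) auto
    fix x y assume "x \<in> (\<lambda>t. t \<odot>\<^bsub>M\<^esub> w) ` B" "y \<in> (\<lambda>t. t \<odot>\<^bsub>M\<^esub> w) ` B"
    then obtain s t where st: "s \<in> B" "t \<in> B" "x = s \<odot>\<^bsub>M\<^esub> w" "y = t \<odot>\<^bsub>M\<^esub> w" by blast
    then have "x \<oplus>\<^bsub>M\<^esub> y = (s \<oplus> t) \<odot>\<^bsub>M\<^esub> w"
      using assms(2) B.Icarr[OF st(1)] B.Icarr[OF st(2)] by (simp add: M.smult_l_distr)
    then show "x \<oplus>\<^bsub>M\<^esub> y \<in> (\<lambda>t. t \<odot>\<^bsub>M\<^esub> w) ` B"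
      using B.a_closed[OF st(1,2)] by blast
  next
    fix c x assume c: "c \<in> carrier R" and "x \<in> (\<lambda>t. t \<odot>\<^bsub>M\<^esub> w) ` B"
    then obtain s where s: "s \<in> B" "x = s \<odot>\<^bsub>M\<^esub> w" by blast
    then have "c \<odot>\<^bsub>M\<^esub> x = (c \<otimes> s) \<odot>\<^bsub>M\<^esub> w"
      using assms(2) c B.Icarr[OF s(1)] by (simp add: M.smult_assoc1)
    then show "c \<odot>\<^bsub>M\<^esub> x \<in> (\<lambda>t. t \<odot>\<^bsub>M\<^esub> w) ` B"
      using B.I_l_closed[OF s(1) c] by blast
  next
    show "(\<lambda>t. t \<odot>\<^bsub>M\<^esub> w) ` B \<subseteq> carrier M"
    proof (rule image_subsetI)
      fix t assume "t \<in> B"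
      then have "t \<in> carrier R" by (rule B.Icarr)
      then show "t \<odot>\<^bsub>M\<^esub> w \<in> carrier M" using assms(2) by (rule M.smult_closed)
    qed
  qed
qed

section \<open>Annihilators and the socle of the canonical module\<close>

definition annih :: "'w set \<Rightarrow> 'a set"
  where "annih N = {c \<in> carrier R. \<forall>x\<in>N. c \<odot>\<^bsub>M\<^esub> x = \<zero>\<^bsub>M\<^esub>}"

text \<open>This is the submodule \<open>0 :_M J\<close>, which corresponds to
  \<open>Hom(R/J, M)\<close>.\<close>

definition torsion :: "'a set \<Rightarrow> 'w set"
  where "torsion J = {x \<in> carrier M. \<forall>c\<in>J. c \<odot>\<^bsub>M\<^esub> x = \<zero>\<^bsub>M\<^esub>}"

lemma annih_ideal: "N \<subseteq> carrier M \<Longrightarrow> ideal (annih N) R"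
  by (rule ideal_of_closed)
    (auto simp: annih_def M.smult_l_distr M.smult_assoc1 subset_iff)

lemma torsion_submodule:
  assumes "J \<subseteq> carrier R"
  shows "submodule R (torsion J) M"
proof (rule submodule_of_closed)
  fix c x assume "c \<in> carrier R" "x \<in> torsion J"
  then show "c \<odot>\<^bsub>M\<^esub> x \<in> torsion J"
    using assms smult_comm[of _ c x] by (auto simp: torsion_def subset_iff)
qed (use assms in \<open>auto simp: torsion_def M.smult_r_distr subset_iff\<close>)

text \<open>The socle of the hull is a copy of the residue field. For a nonzero socle element
  \<open>x\<close>, essentiality gives a nonzero \<open>y = rx = cv\<close> in the image of the
  embedding; \<open>r\<close> is a unit because \<open>\<mm>\<close> kills \<open>x\<close>, so
  \<open>x\<close> is a multiple of \<open>v\<close>.\<close>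

lemma socle_generator:
  obtains v where "v \<in> carrier M" "v \<noteq> \<zero>\<^bsub>M\<^esub>" "\<And>z. z \<in> \<mm> \<Longrightarrow> z \<odot>\<^bsub>M\<^esub> v = \<zero>\<^bsub>M\<^esub>"
    "\<And>x. x \<in> carrier M \<Longrightarrow> x \<noteq> \<zero>\<^bsub>M\<^esub> \<Longrightarrow> (\<And>z. z \<in> \<mm> \<Longrightarrow> z \<odot>\<^bsub>M\<^esub> x = \<zero>\<^bsub>M\<^esub>) \<Longrightarrow> 
      \<exists>r\<in>carrier R. x = r \<odot>\<^bsub>M\<^esub> v"
proof -
  let ?k = "quotient_module R \<mm>"
  obtain \<iota> where \<iota>: "\<iota> \<in> module_hom R ?k M" "inj_on \<iota> (carrier ?k)"
    and essential: "\<And>N. submodule R N M \<Longrightarrow> N \<noteq> {\<zero>\<^bsub>M\<^esub>} \<Longrightarrow> N \<inter> \<iota> ` carrier ?k \<noteq> {\<zero>\<^bsub>M\<^esub>}"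
    using canonical unfolding canonical_module_def injective_hull_def by blast
  have k: "carrier ?k = (\<lambda>c. \<mm> +> c) ` carrier R"
    by (auto simp: quotient_module_def FactRing_def A_RCOSETS_def')
  have smult_k: "c \<odot>\<^bsub>?k\<^esub> (\<mm> +> d) = \<mm> +> c \<otimes> d" if "c \<in> carrier R" "d \<in> carrier R" for c d
    using that by (simp add: quotient_module_def FactRing_def maximal.rcoset_mult_add)
  have \<iota>_smult: "\<iota> (c \<odot>\<^bsub>?k\<^esub> X) = c \<odot>\<^bsub>M\<^esub> \<iota> X" if "c \<in> carrier R" "X \<in> carrier ?k" for c X
    using \<iota>(1) that by (simp add: module_hom_def)
  \<comment> \<open>With \<open>v\<close> the image of the residue class of \<open>1\<close>, the
    embedding is multiplication of \<open>v\<close> by representatives.\<close>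
  define v where "v = \<iota> (\<mm> +> \<one>)"
  have one: "\<mm> +> \<one> \<in> carrier ?k" by (simp add: k)
  have v: "v \<in> carrier M" using \<iota>(1) one by (auto simp: v_def module_hom_def)
  have \<iota>v: "\<iota> (\<mm> +> c) = c \<odot>\<^bsub>M\<^esub> v" if "c \<in> carrier R" for c
    using \<iota>_smult[OF that one] smult_k[OF that R.one_closed] that by (simp add: v_def)
  have "\<zero> \<odot>\<^bsub>M\<^esub> v = \<zero>\<^bsub>M\<^esub>" using v by simp
  then have \<iota>0: "\<iota> (\<mm> +> \<zero>) = \<zero>\<^bsub>M\<^esub>" using \<iota>v[of \<zero>] by simp
  have "v \<noteq> \<zero>\<^bsub>M\<^esub>"
  proof
    assume "v = \<zero>\<^bsub>M\<^esub>"
    then have "\<mm> +> \<one> = \<mm> +> \<zero>"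
      using \<iota>0 one k unfolding v_def by (intro inj_onD[OF \<iota>(2)]) auto
    moreover have "\<one> \<in> \<mm> +> \<one>" by (rule maximal.a_rcos_self) simp
    ultimately show False using one_notin R.a_coset_add_zero[OF maximal.a_subset] by simp
  qed
  moreover have zv: "z \<odot>\<^bsub>M\<^esub> v = \<zero>\<^bsub>M\<^esub>" if "z \<in> \<mm>" for z
  proof -
    have "\<mm> +> z = \<mm> +> \<zero>"
      using R.a_rcos_zero[OF maximal.is_ideal that] R.a_coset_add_zero[OF maximal.a_subset] by simp
    then show ?thesis using \<iota>v[of z] \<iota>0 maximal.Icarr[OF that] by simp
  qed
  moreover have "\<exists>r\<in>carrier R. x = r \<odot>\<^bsub>M\<^esub> v"
    if x: "x \<in> carrier M" "x \<noteq> \<zero>\<^bsub>M\<^esub>" "\<And>z. z \<in> \<mm> \<Longrightarrow> z \<odot>\<^bsub>M\<^esub> x = \<zero>\<^bsub>M\<^esub>" for x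
  proof -
    define N where "N = (\<lambda>r. r \<odot>\<^bsub>M\<^esub> x) ` carrier R"
    have N: "submodule R N M"
    proof (rule submodule_of_closed)
      show "\<zero>\<^bsub>M\<^esub> \<in> N" unfolding N_def using x by (intro image_eqI[of _ _ \<zero>]) auto
      fix y y' assume "y \<in> N" "y' \<in> N"
      then show "y \<oplus>\<^bsub>M\<^esub> y' \<in> N"
        using x by (auto simp: N_def simp flip: M.smult_l_distr)
    next
      fix c y assume "c \<in> carrier R" "y \<in> N"
      then show "c \<odot>\<^bsub>M\<^esub> y \<in> N"
        using x by (auto simp: N_def simp flip: M.smult_assoc1)
    qed (use x in \<open>auto simp: N_def\<close>)
    have "x \<in> N" unfolding N_def using x by (intro image_eqI[of _ _ \<one>]) auto
    then have "N \<inter> \<iota> ` carrier ?k \<noteq> {\<zero>\<^bsub>M\<^esub>}" using essential[OF N] x(2) by blast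
    moreover have "\<zero>\<^bsub>M\<^esub> \<in> N \<inter> \<iota> ` carrier ?k"
      using \<iota>0 submodule.zero_closed[OF N] unfolding k
      by (metis IntI R.zero_closed image_eqI)
    ultimately obtain y where y: "y \<in> N" "y \<in> \<iota> ` carrier ?k" "y \<noteq> \<zero>\<^bsub>M\<^esub>" by blast
    obtain r where r: "r \<in> carrier R" "y = r \<odot>\<^bsub>M\<^esub> x" using y(1) by (auto simp: N_def)
    obtain c where c: "c \<in> carrier R" "y = c \<odot>\<^bsub>M\<^esub> v" using y(2) \<iota>v by (auto simp: k)
    have "r \<notin> \<mm>" using y(3) r x(3) by auto
    with r(1) obtain s where s: "s \<in> carrier R" "s \<otimes> r = \<one>" by (rule unit_if_notin)
    have "x = (s \<otimes> r) \<odot>\<^bsub>M\<^esub> x" using s x by simp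
    also have "\<dots> = s \<odot>\<^bsub>M\<^esub> (c \<odot>\<^bsub>M\<^esub> v)"
      using s(1) r x(1) c(2) by (simp add: M.smult_assoc1)
    also have "\<dots> = (s \<otimes> c) \<odot>\<^bsub>M\<^esub> v" using s(1) c(1) v by (simp add: M.smult_assoc1)
    finally show ?thesis using s(1) c(1) by blast
  qed
  ultimately show thesis using v that by blast
qed

text \<open>Both elements are multiples of the socle generator, and the coefficient of the nonzero
  one is a unit.\<close>

lemma socle_ratio:
  assumes "x \<in> carrier M" "x \<noteq> \<zero>\<^bsub>M\<^esub>" "\<And>z. z \<in> \<mm> \<Longrightarrow> z \<odot>\<^bsub>M\<^esub> x = \<zero>\<^bsub>M\<^esub>"
    and "y \<in> carrier M" "\<And>z. z \<in> \<mm> \<Longrightarrow> z \<odot>\<^bsub>M\<^esub> y = \<zero>\<^bsub>M\<^esub>"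
  obtains r where "r \<in> carrier R" "y = r \<odot>\<^bsub>M\<^esub> x"
proof (cases "y = \<zero>\<^bsub>M\<^esub>")
  case True
  then show thesis using that[of \<zero>] assms(1) by simp
next
  case False
  obtain v where v: "v \<in> carrier M" "\<And>z. z \<in> \<mm> \<Longrightarrow> z \<odot>\<^bsub>M\<^esub> v = \<zero>\<^bsub>M\<^esub>"
    and gen: "\<And>x. x \<in> carrier M \<Longrightarrow> x \<noteq> \<zero>\<^bsub>M\<^esub> \<Longrightarrow> (\<And>z. z \<in> \<mm> \<Longrightarrow> z \<odot>\<^bsub>M\<^esub> x = \<zero>\<^bsub>M\<^esub>) \<Longrightarrow>
      \<exists>r\<in>carrier R. x = r \<odot>\<^bsub>M\<^esub> v"
    by (rule socle_generator) blast
  obtain a where a: "a \<in> carrier R" "x = a \<odot>\<^bsub>M\<^esub> v" using gen[OF assms(1-3)] by blast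
  obtain b where b: "b \<in> carrier R" "y = b \<odot>\<^bsub>M\<^esub> v" using gen[OF assms(4) False assms(5)] by blast
  have "a \<notin> \<mm>" using a(2) assms(2) v(2) by auto
  with a(1) obtain s where s: "s \<in> carrier R" "s \<otimes> a = \<one>" by (rule unit_if_notin)
  have "y = (b \<otimes> (s \<otimes> a)) \<odot>\<^bsub>M\<^esub> v" using b s by simp
  also have "\<dots> = (b \<otimes> s) \<odot>\<^bsub>M\<^esub> x"
    using a b(1) s(1) v(1) by (simp add: M.smult_assoc1)
  finally show thesis using that[of "b \<otimes> s"] b(1) s(1) by simp
qed

section \<open>Length comparison and the double annihilator property\<close>

text \<open>Chains with successive quotients of length at most one: from \<open>J\<close> up to \<open>R\<close>, and from \<open>0\<close> up to \<open>N\<close>.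
  Repetitions are allowed, so that \<open>n\<close> only bounds the length from above.\<close>

inductive ideal_chain :: "'a set \<Rightarrow> nat \<Rightarrow> bool" where
  top: "ideal_chain (carrier R) 0"
| step: "ideal_chain J' n \<Longrightarrow> ideal J R \<Longrightarrow> J \<subseteq> J' \<Longrightarrow> u \<in> carrier R \<Longrightarrow>
    (\<And>z. z \<in> \<mm> \<Longrightarrow> z \<otimes> u \<in> J) \<Longrightarrow> J' \<subseteq> J <+>\<^bsub>R\<^esub> PIdl u \<Longrightarrow> ideal_chain J (Suc n)"

inductive submodule_chain :: "'w set \<Rightarrow> nat \<Rightarrow> bool" where
  bottom: "submodule_chain {\<zero>\<^bsub>M\<^esub>} 0"
| step: "submodule_chain N n \<Longrightarrow> submodule R N' M \<Longrightarrow> N \<subseteq> N' \<Longrightarrow> x \<in> N' \<Longrightarrow>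
    (\<And>z. z \<in> \<mm> \<Longrightarrow> z \<odot>\<^bsub>M\<^esub> x \<in> N) \<Longrightarrow>
    (\<And>y. y \<in> N' \<Longrightarrow> \<exists>k\<in>N. \<exists>r\<in>carrier R. y = k \<oplus>\<^bsub>M\<^esub> r \<odot>\<^bsub>M\<^esub> x) \<Longrightarrow> submodule_chain N' (Suc n)"

lemma submodule_chain_submodule: "submodule_chain N n \<Longrightarrow> submodule R N M"
  by (induction rule: submodule_chain.induct) (auto intro!: submodule_of_closed)

text \<open>By Noetherian induction: a proper ideal is enlarged by an element whose class lies in
  the socle of the quotient.\<close>

lemma ideal_chain_exists:
  assumes "ideal J R"
  shows "\<exists>n. ideal_chain J n"
  using assms
proof (induction rule: noetherian_ideal_induct)
  case (step J)
  show ?case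
  proof (cases "J = carrier R")
    case True
    then show ?thesis using ideal_chain.top by auto
  next
    case False
    obtain u where u: "u \<in> carrier R" "u \<notin> J" "\<And>z. z \<in> \<mm> \<Longrightarrow> z \<otimes> u \<in> J"
      using exists_socle_element[OF step(1) False] by blast
    note J' = add_cgenideal_strict[OF step(1) u(1,2)]
    obtain n where "ideal_chain (J <+>\<^bsub>R\<^esub> PIdl u) n" using step(2)[OF J'(1,2)] by blast
    then have "ideal_chain J (Suc n)"
      using step(1) u(1,3) J'(2) by (intro ideal_chain.step[of _ n J u]) auto
    then show ?thesis by blast
  qed
qed

text \<open>This trades the generator \<open>x\<close> of a chain step for another element
  \<open>y\<close> whose \<open>x\<close>-coefficient is a unit.\<close>

lemma solve_unit_coefficient:
  assumes "k \<in> carrier M" "x \<in> carrier M" "r \<in> carrier R" "s \<in> carrier R" "s \<otimes> r = \<one>"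
    and "y = k \<oplus>\<^bsub>M\<^esub> r \<odot>\<^bsub>M\<^esub> x"
  shows "x = (\<ominus> s) \<odot>\<^bsub>M\<^esub> k \<oplus>\<^bsub>M\<^esub> s \<odot>\<^bsub>M\<^esub> y"
proof -
  have "s \<odot>\<^bsub>M\<^esub> y = s \<odot>\<^bsub>M\<^esub> k \<oplus>\<^bsub>M\<^esub> (s \<otimes> r) \<odot>\<^bsub>M\<^esub> x"
    using assms(1-4,6) by (simp add: M.smult_r_distr M.smult_assoc1)
  then show ?thesis
    using assms(1-5) by (simp add: M.smult_l_minus M.a_assoc[symmetric] M.l_neg)
qed

text \<open>The chain is intersected with \<open>K\<close>. A step either collapses, and the chain
  gets shorter, or it survives with a new generator \<open>y\<close> from \<open>K\<close>. If every
  step survives, all generators of the original chain lie in \<open>K\<close>. The strict bound is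
  what the double annihilator argument uses.\<close>

lemma submodule_chain_restrict:
  assumes "submodule_chain N' n" "submodule R K M" "K \<subseteq> N'"
  shows "\<exists>k\<le>n. submodule_chain K k \<and> (K \<noteq> N' \<longrightarrow> k < n)"
  using assms
proof (induction arbitrary: K rule: submodule_chain.induct)
  case bottom
  then have "K = {\<zero>\<^bsub>M\<^esub>}" using submodule.zero_closed by blast
  then show ?case using submodule_chain.bottom by blast
next
  case (step N n N' x)
  interpret K: submodule R K M by fact
  interpret N: submodule R N M using step.hyps(1) by (rule submodule_chain_submodule)
  interpret N': submodule R N' M by fact
  have x: "x \<in> carrier M" using step.hyps N'.subset by blast
  have KN: "submodule R (K \<inter> N) M"
    using K.subset by (intro submodule_of_closed) auto
  obtain k where k: "k \<le> n" "submodule_chain (K \<inter> N) k" "K \<inter> N \<noteq> N \<longrightarrow> k < n"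
    using step.IH[OF KN] by blast
  show ?case
  proof (cases "K \<subseteq> N")
    case True
    then have "K \<inter> N = K" by blast
    with k show ?thesis by (intro exI[of _ k]) auto
  next
    case False
    then obtain y where y: "y \<in> K" "y \<notin> N" by blast
    then obtain n0 r where n0: "n0 \<in> N" and r: "r \<in> carrier R" and y_eq: "y = n0 \<oplus>\<^bsub>M\<^esub> r \<odot>\<^bsub>M\<^esub> x"
      using step.hyps(6)[of y] step.prems(2) by blast
    have yM: "y \<in> carrier M" and n0M: "n0 \<in> carrier M"
      using y K.subset n0 N.subset by auto
    have "r \<notin> \<mm>"
      using y(2) n0 step.hyps(5)[of r] N.m_closed[of n0 "r \<odot>\<^bsub>M\<^esub> x"] y_eq by blast
    with r obtain s where s: "s \<in> carrier R" "s \<otimes> r = \<one>" by (rule unit_if_notin)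
    have x_eq: "x = (\<ominus> s) \<odot>\<^bsub>M\<^esub> n0 \<oplus>\<^bsub>M\<^esub> s \<odot>\<^bsub>M\<^esub> y"
      using n0M x r s y_eq by (rule solve_unit_coefficient)
    have zy: "z \<odot>\<^bsub>M\<^esub> y \<in> K \<inter> N" if "z \<in> \<mm>" for z
    proof -
      have z: "z \<in> carrier R" using that maximal.Icarr by blast
      have "z \<odot>\<^bsub>M\<^esub> y = z \<odot>\<^bsub>M\<^esub> n0 \<oplus>\<^bsub>M\<^esub> r \<odot>\<^bsub>M\<^esub> (z \<odot>\<^bsub>M\<^esub> x)"
        using z r n0M x y_eq by (simp add: M.smult_r_distr smult_comm)
      also have "\<dots> \<in> N"
        using N.m_closed[OF N.smult_closed[OF z n0] N.smult_closed[OF r step.hyps(5)[OF that]]] .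
      finally show ?thesis using z y(1) K.smult_closed by blast
    qed
    have gen: "\<exists>k\<in>K \<inter> N. \<exists>r\<in>carrier R. y' = k \<oplus>\<^bsub>M\<^esub> r \<odot>\<^bsub>M\<^esub> y" if y': "y' \<in> K" for y'
    proof -
      obtain n' r' where n': "n' \<in> N" and r': "r' \<in> carrier R" and y'_eq: "y' = n' \<oplus>\<^bsub>M\<^esub> r' \<odot>\<^bsub>M\<^esub> x"
        using step.hyps(6)[of y'] step.prems(2) y' by blast
      define k' where "k' = n' \<oplus>\<^bsub>M\<^esub> (r' \<otimes> \<ominus> s) \<odot>\<^bsub>M\<^esub> n0"
      have k'N: "k' \<in> N" unfolding k'_def using n' n0 r' s(1)
        by (intro N.m_closed N.smult_closed) auto
      then have k'M: "k' \<in> carrier M" using N.subset by blast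
      have "r' \<odot>\<^bsub>M\<^esub> x = (r' \<otimes> \<ominus> s) \<odot>\<^bsub>M\<^esub> n0 \<oplus>\<^bsub>M\<^esub> (r' \<otimes> s) \<odot>\<^bsub>M\<^esub> y"
        by (subst x_eq) (use r' s(1) n0M yM in \<open>simp add: M.smult_r_distr M.smult_assoc1\<close>)
      then have eq: "y' = k' \<oplus>\<^bsub>M\<^esub> (r' \<otimes> s) \<odot>\<^bsub>M\<^esub> y"
        unfolding k'_def y'_eq using n' N.subset r' s(1) n0M yM
        by (subst M.a_assoc) auto
      have "k' \<in> K"
        using y' eq r' s(1) y(1) K.smult_closed[of "r' \<otimes> s" y]
        by (intro submodule_summandL[OF K.submodule_axioms k'M, of "(r' \<otimes> s) \<odot>\<^bsub>M\<^esub> y"]) auto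
      with k'N eq r' s(1) show ?thesis by blast
    qed
    have "submodule_chain K (Suc k)"
      using k(2) K.submodule_axioms y(1) zy gen by (intro submodule_chain.step[of "K \<inter> N" k K y]) auto
    moreover have "k < n" if "K \<noteq> N'"
    proof (rule ccontr)
      \<comment> \<open>The induction hypothesis then gives \<open>K \<inter> N = N\<close>. Hence
        \<open>n0\<close> lies in \<open>K\<close>, and solving for \<open>x\<close> in terms of
        \<open>n0\<close> and \<open>y\<close> puts the old generator into \<open>K\<close>
        too.\<close>
      assume "\<not> k < n"
      then have "N \<subseteq> K" using k(3) by blast
      then have "x \<in> K"
        using x_eq n0 s(1) y(1) K.m_closed[OF K.smult_closed[of "\<ominus> s" n0] K.smult_closed[of s y]] by auto
      then have "y' \<in> K" if "y' \<in> N'" for y'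
        using step.hyps(6)[OF that] \<open>N \<subseteq> K\<close> by (auto intro!: K.m_closed K.smult_closed)
      with step.prems(2) \<open>K \<noteq> N'\<close> show False by blast
    qed
    ultimately show ?thesis using k(1) by (intro exI[of _ "Suc k"]) auto
  qed
qed

text \<open>At a step with socle element \<open>u\<close>, multiplication by \<open>u\<close> maps
  \<open>torsion J\<close> into the socle of \<open>M\<close>, and its kernel lies in
  \<open>torsion J'\<close>. As the socle is generated by one element, a single \<open>x\<close>
  generates \<open>torsion J\<close> over \<open>torsion J'\<close>.\<close>

lemma torsion_chain:
  assumes "ideal_chain J n"
  shows "submodule_chain (torsion J) n"
  using assms
proof (induction rule: ideal_chain.induct)
  case top
  have "x = \<zero>\<^bsub>M\<^esub>" if "x \<in> torsion (carrier R)" for x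
    using that M.smult_one[of x] unfolding torsion_def by auto
  then have "torsion (carrier R) = {\<zero>\<^bsub>M\<^esub>}" by (auto simp: torsion_def)
  then show ?case using submodule_chain.bottom by simp
next
  case (step J' n J u)
  interpret J: ideal J R by fact
  have sub: "torsion J' \<subseteq> torsion J" using step.hyps(3) by (auto simp: torsion_def)
  have T: "submodule R (torsion J) M" using J.a_subset by (rule torsion_submodule)
  have in_J': "y \<in> torsion J'" if y: "y \<in> torsion J" "u \<odot>\<^bsub>M\<^esub> y = \<zero>\<^bsub>M\<^esub>" for y
  proof -
    have "c \<odot>\<^bsub>M\<^esub> y = \<zero>\<^bsub>M\<^esub>" if c: "c \<in> J'" for c
    proof -
      obtain j r where "j \<in> J" "r \<in> carrier R" "c = j \<oplus> r \<otimes> u"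
        using subsetD[OF step.hyps(6) c] unfolding R.add_cgenideal_iff by blast
      then show ?thesis
        using y step.hyps(4) J.Icarr by (simp add: torsion_def M.smult_l_distr M.smult_assoc1)
    qed
    then show ?thesis using y by (auto simp: torsion_def)
  qed
  have soc: "z \<odot>\<^bsub>M\<^esub> (u \<odot>\<^bsub>M\<^esub> y) = \<zero>\<^bsub>M\<^esub>" if "z \<in> \<mm>" "y \<in> torsion J" for z y
    using that step.hyps(4,5) maximal.Icarr by (simp add: torsion_def flip: M.smult_assoc1)
  show ?case
  \<comment> \<open>If \<open>u\<close> kills \<open>torsion J\<close>, the two torsion submodules
    agree; the step is then a repetition, recorded with generator zero.\<close>
  proof (cases "\<forall>y\<in>torsion J. u \<odot>\<^bsub>M\<^esub> y = \<zero>\<^bsub>M\<^esub>")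
    case True
    show ?thesis
    proof (rule submodule_chain.step[OF step.IH T sub, of "\<zero>\<^bsub>M\<^esub>"])
      show "\<zero>\<^bsub>M\<^esub> \<in> torsion J" using T by (rule submodule.zero_closed)
      show "z \<odot>\<^bsub>M\<^esub> \<zero>\<^bsub>M\<^esub> \<in> torsion J'" if "z \<in> \<mm>" for z
        using submodule.zero_closed[OF submodule_chain_submodule[OF step.IH]] that maximal.Icarr by simp
      fix y assume y: "y \<in> torsion J"
      then have "y = y \<oplus>\<^bsub>M\<^esub> \<zero> \<odot>\<^bsub>M\<^esub> \<zero>\<^bsub>M\<^esub>" by (simp add: torsion_def)
      then show "\<exists>k\<in>torsion J'. \<exists>r\<in>carrier R. y = k \<oplus>\<^bsub>M\<^esub> r \<odot>\<^bsub>M\<^esub> \<zero>\<^bsub>M\<^esub>"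
        using in_J' True y by blast
    qed
  next
    case False
    then obtain x where x: "x \<in> torsion J" "u \<odot>\<^bsub>M\<^esub> x \<noteq> \<zero>\<^bsub>M\<^esub>" by blast
    have xM: "x \<in> carrier M" using x by (simp add: torsion_def)
    show ?thesis
    proof (rule submodule_chain.step[OF step.IH T sub x(1)])
      fix z assume z: "z \<in> \<mm>"
      then have zR: "z \<in> carrier R" by (rule maximal.Icarr)
      show "z \<odot>\<^bsub>M\<^esub> x \<in> torsion J'"
      proof (rule in_J')
        show "z \<odot>\<^bsub>M\<^esub> x \<in> torsion J" using T zR x(1) by (rule submodule.smult_closed)
        show "u \<odot>\<^bsub>M\<^esub> (z \<odot>\<^bsub>M\<^esub> x) = \<zero>\<^bsub>M\<^esub>"
          using soc[OF z x(1)] smult_comm[OF step.hyps(4) zR xM] by simp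
      qed
    next
      fix y assume y: "y \<in> torsion J"
      then have yM: "y \<in> carrier M" by (simp add: torsion_def)
      obtain r where r: "r \<in> carrier R" "u \<odot>\<^bsub>M\<^esub> y = r \<odot>\<^bsub>M\<^esub> (u \<odot>\<^bsub>M\<^esub> x)"
        by (rule socle_ratio[OF M.smult_closed[OF step.hyps(4) xM] x(2) soc[OF _ x(1)]
              M.smult_closed[OF step.hyps(4) yM] soc[OF _ y]])
      \<comment> \<open>Subtracting this multiple of \<open>x\<close> from \<open>y\<close> lands in
        the kernel of \<open>u\<close>, hence in \<open>torsion J'\<close>.\<close>
      define k where "k = y \<oplus>\<^bsub>M\<^esub> (\<ominus> r) \<odot>\<^bsub>M\<^esub> x"
      have "k \<in> torsion J" unfolding k_def
        using submodule.m_closed[OF T y submodule.smult_closed[OF T _ x(1)]] r(1) by simp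
      moreover have "u \<odot>\<^bsub>M\<^esub> k = \<zero>\<^bsub>M\<^esub>"
        using r step.hyps(4) xM yM
        by (simp add: k_def M.smult_r_distr M.smult_l_minus M.smult_r_minus smult_comm[of u r] M.r_neg)
      ultimately have "k \<in> torsion J'" by (rule in_J')
      moreover have "y = k \<oplus>\<^bsub>M\<^esub> r \<odot>\<^bsub>M\<^esub> x"
        using r(1) xM yM by (simp add: k_def M.smult_l_minus M.a_assoc M.l_neg)
      ultimately show "\<exists>k\<in>torsion J'. \<exists>r\<in>carrier R. y = k \<oplus>\<^bsub>M\<^esub> r \<odot>\<^bsub>M\<^esub> x"
        using r(1) by blast
    qed
  qed
qed

text \<open>The mirror image of the preceding argument: \<open>c \<mapsto> c x\<close> maps
  \<open>annih N\<close> into the socle of \<open>M\<close>, because \<open>\<mm>\<close> sends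
  \<open>x\<close> into \<open>N\<close>, and its kernel lies in \<open>annih N'\<close>.\<close>

lemma annih_chain:
  assumes "submodule_chain N n"
  shows "ideal_chain (annih N) n"
  using assms
proof (induction rule: submodule_chain.induct)
  case bottom
  have "annih {\<zero>\<^bsub>M\<^esub>} = carrier R" by (auto simp: annih_def)
  then show ?case using ideal_chain.top by simp
next
  case (step N n N' x)
  interpret N: submodule R N M using step.hyps(1) by (rule submodule_chain_submodule)
  interpret N': submodule R N' M by fact
  have xM: "x \<in> carrier M" using step.hyps N'.subset by blast
  have A': "ideal (annih N') R" using N'.subset by (rule annih_ideal)
  have sub: "annih N' \<subseteq> annih N" using step.hyps(3) by (auto simp: annih_def)
  have in_N': "c \<in> annih N'" if c: "c \<in> annih N" "c \<odot>\<^bsub>M\<^esub> x = \<zero>\<^bsub>M\<^esub>" for c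
  proof -
    have "c \<odot>\<^bsub>M\<^esub> y = \<zero>\<^bsub>M\<^esub>" if y: "y \<in> N'" for y
    proof -
      obtain k r where "k \<in> N" "r \<in> carrier R" "y = k \<oplus>\<^bsub>M\<^esub> r \<odot>\<^bsub>M\<^esub> x"
        using step.hyps(6)[OF y] by blast
      then show ?thesis
        using c xM N.subset by (auto simp: annih_def M.smult_r_distr smult_comm[of c r] subset_iff)
    qed
    then show ?thesis using c by (auto simp: annih_def)
  qed
  have soc: "z \<odot>\<^bsub>M\<^esub> (c \<odot>\<^bsub>M\<^esub> x) = \<zero>\<^bsub>M\<^esub>" if "z \<in> \<mm>" "c \<in> annih N" for z c
    using that step.hyps(5)[OF that(1)] xM maximal.Icarr[OF that(1)]
    by (simp add: annih_def smult_comm[of z c])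
  show ?case
  \<comment> \<open>Again a step may degenerate to a repetition, with generator zero; otherwise any
    \<open>u\<close> with \<open>u x\<close> nonzero generates.\<close>
  proof (cases "\<forall>c\<in>annih N. c \<odot>\<^bsub>M\<^esub> x = \<zero>\<^bsub>M\<^esub>")
    case True
    then have eq: "annih N' = annih N" using in_N' sub by blast
    show ?thesis
    proof (rule ideal_chain.step[OF step.IH A' sub, of \<zero>])
      show "annih N \<subseteq> annih N' <+>\<^bsub>R\<^esub> PIdl \<zero>"
      proof
        fix c assume c: "c \<in> annih N"
        then have "c = c \<oplus> \<zero> \<otimes> \<zero>" by (simp add: annih_def)
        then show "c \<in> annih N' <+>\<^bsub>R\<^esub> PIdl \<zero>"
          unfolding R.add_cgenideal_iff eq using c by blast
      qed
    qed (use maximal.Icarr A' in \<open>auto simp: additive_subgroup.zero_closed ideal_def\<close>)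
  next
    case False
    then obtain u where u: "u \<in> annih N" "u \<odot>\<^bsub>M\<^esub> x \<noteq> \<zero>\<^bsub>M\<^esub>" by blast
    have uR: "u \<in> carrier R" using u by (simp add: annih_def)
    interpret A: ideal "annih N" R using N.subset by (rule annih_ideal)
    show ?thesis
    proof (rule ideal_chain.step[OF step.IH A' sub uR])
      fix z assume z: "z \<in> \<mm>"
      then have zR: "z \<in> carrier R" by (rule maximal.Icarr)
      show "z \<otimes> u \<in> annih N'"
      proof (rule in_N')
        show "z \<otimes> u \<in> annih N" using u(1) zR by (rule A.I_l_closed)
        show "(z \<otimes> u) \<odot>\<^bsub>M\<^esub> x = \<zero>\<^bsub>M\<^esub>"
          using soc[OF z u(1)] M.smult_assoc1[OF zR uR xM] by simp
      qed
    next
      show "annih N \<subseteq> annih N' <+>\<^bsub>R\<^esub> PIdl u"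
      proof (rule subsetI)
        fix c assume c: "c \<in> annih N"
        then have cR: "c \<in> carrier R" by (rule A.Icarr)
        obtain r where r: "r \<in> carrier R" "c \<odot>\<^bsub>M\<^esub> x = r \<odot>\<^bsub>M\<^esub> (u \<odot>\<^bsub>M\<^esub> x)"
          by (rule socle_ratio[OF M.smult_closed[OF uR xM] u(2) soc[OF _ u(1)]
                M.smult_closed[OF cR xM] soc[OF _ c]])
        have "c \<ominus> r \<otimes> u \<in> annih N"
          unfolding R.minus_eq using A.a_closed[OF c A.a_inv_closed[OF A.I_l_closed[OF u(1) r(1)]]] .
        moreover have "(c \<ominus> r \<otimes> u) \<odot>\<^bsub>M\<^esub> x = \<zero>\<^bsub>M\<^esub>"
          using r uR cR xM
          by (simp add: R.minus_eq M.smult_l_distr M.smult_l_minus M.smult_assoc1 M.r_neg)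
        ultimately have "c \<ominus> r \<otimes> u \<in> annih N'" by (rule in_N')
        moreover have "c = (c \<ominus> r \<otimes> u) \<oplus> r \<otimes> u"
          using r(1) uR cR by (simp add: R.minus_eq R.a_assoc R.l_neg)
        ultimately show "c \<in> annih N' <+>\<^bsub>R\<^esub> PIdl u"
          unfolding R.add_cgenideal_iff using r(1) by blast
      qed
    qed
  qed
qed

text \<open>Annihilators carry chains in \<open>M\<close> to chains in \<open>R\<close> of the same length, and conversely. With \<open>n\<close> minimal for
  \<open>ann N\<close>, a proper inclusion of \<open>N\<close> in the module killed by \<open>ann N\<close> would yield a chain shorter than \<open>n\<close>.\<close>

lemma double_annihilator:
  assumes N: "submodule R N M" and x: "x \<in> carrier M"
    and killed: "\<And>c. c \<in> annih N \<Longrightarrow> c \<odot>\<^bsub>M\<^esub> x = \<zero>\<^bsub>M\<^esub>"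
  shows "x \<in> N"
proof -
  interpret N: submodule R N M by fact
  define n where "n = (LEAST n. ideal_chain (annih N) n)"
  have "ideal_chain (annih N) n"
    unfolding n_def using ideal_chain_exists[OF annih_ideal[OF N.subset]] by (rule LeastI_ex)
  then have "submodule_chain (torsion (annih N)) n" by (rule torsion_chain)
  moreover have "N \<subseteq> torsion (annih N)"
    using N.subset by (auto simp: torsion_def annih_def)
  ultimately obtain k where k: "submodule_chain N k" "N \<noteq> torsion (annih N) \<longrightarrow> k < n"
    using submodule_chain_restrict[OF _ N] by blast
  have "n \<le> k" unfolding n_def using annih_chain[OF k(1)] by (rule Least_le)
  then have "N = torsion (annih N)" using k(2) by auto
  then show ?thesis using x killed by (auto simp: torsion_def)
qed

section \<open>Consequences of injectivity: extension from ideals and prescribed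
  annihilators\<close>

text \<open>Ideals in this form serve as the domains of the maps to be extended by
  injectivity.\<close>

lemma self_module_submodule:
  assumes "ideal A R"
  shows "module R (self_module R\<lparr>carrier := A\<rparr>)"
proof -
  interpret A: ideal A R by fact
  show ?thesis
  proof (rule moduleI)
    show "cring R" by (rule R.is_cring)
    show "abelian_group (self_module R\<lparr>carrier := A\<rparr>)"
    proof (rule abelian_groupI)
      fix x assume "x \<in> carrier (self_module R\<lparr>carrier := A\<rparr>)"
      then show "\<exists>y\<in>carrier (self_module R\<lparr>carrier := A\<rparr>).
          y \<oplus>\<^bsub>self_module R\<lparr>carrier := A\<rparr>\<^esub> x = \<zero>\<^bsub>self_module R\<lparr>carrier := A\<rparr>\<^esub>"
        using A.a_inv_closed R.l_neg[OF A.Icarr] by (auto simp: self_module_def)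
    qed (use A.Icarr in \<open>auto simp: self_module_def R.a_ac\<close>)
  qed (use A.Icarr A.I_l_closed in \<open>auto simp: self_module_def R.l_distr R.r_distr R.m_assoc\<close>)
qed

lemma self_module_simps:
  "carrier (self_module R) = carrier R" "x \<oplus>\<^bsub>self_module R\<^esub> y = x \<oplus> y"
  "x \<odot>\<^bsub>self_module R\<^esub> y = x \<otimes> y"
  by (simp_all add: self_module_def)

text \<open>Injectivity extends \<open>g\<close> along the inclusion of \<open>A\<close> in
  \<open>R\<close>, and a homomorphism on \<open>R\<close> is determined by its value at
  \<open>1\<close>, which serves as \<open>w\<close>.\<close>

lemma baer_extension:
  assumes A: "ideal A R" and g: "g \<in> A \<rightarrow> carrier M"
    "\<And>a b. a \<in> A \<Longrightarrow> b \<in> A \<Longrightarrow> g (a \<oplus> b) = g a \<oplus>\<^bsub>M\<^esub> g b"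
    "\<And>r a. r \<in> carrier R \<Longrightarrow> a \<in> A \<Longrightarrow> g (r \<otimes> a) = r \<odot>\<^bsub>M\<^esub> g a"
  obtains w where "w \<in> carrier M" "\<And>a. a \<in> A \<Longrightarrow> g a = a \<odot>\<^bsub>M\<^esub> w"
proof -
  interpret A: ideal A R by fact
  let ?A = "self_module R\<lparr>carrier := A\<rparr>"
  have inj: "injective_module R M"
    using canonical by (simp add: canonical_module_def injective_hull_def)
  have "self_module R\<lparr>carrier := carrier R\<rparr> = self_module R" by (simp add: self_module_def)
  then have mod: "module R ?A" "module R (self_module R)"
    using self_module_submodule[OF A] self_module_submodule[OF R.oneideal] by simp_all
  have "(\<lambda>x. x) \<in> module_hom R ?A (self_module R)"
    using A.a_subset by (auto simp: module_hom_def self_module_def)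
  moreover have "g \<in> module_hom R ?A M"
    using g by (auto simp: module_hom_def self_module_def)
  ultimately obtain h where h: "h \<in> module_hom R (self_module R) M" "\<forall>x\<in>carrier ?A. h x = g x"
    using inj[unfolded injective_module_def, THEN conjunct2, THEN spec[of _ ?A],
        THEN spec[of _ "self_module R"], THEN spec[of _ "\<lambda>x. x"], THEN spec[of _ g]] mod
    by (auto simp: inj_on_def)
  have "g a = a \<odot>\<^bsub>M\<^esub> h \<one>" if a: "a \<in> A" for a
  proof -
    have "a \<in> carrier R" using a by (rule A.Icarr)
    then have "h (a \<otimes> \<one>) = a \<odot>\<^bsub>M\<^esub> h \<one>"
      using h(1) R.one_closed unfolding module_hom_def self_module_simps by blast
    then show ?thesis using h(2) a \<open>a \<in> carrier R\<close> by simp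
  qed
  moreover have "h \<one> \<in> carrier M"
    using h(1) R.one_closed unfolding module_hom_def self_module_simps by blast
  ultimately show thesis using that by blast
qed

text \<open>On \<open>q + Rr\<close> the assignment \<open>c + sr \<mapsto> s v\<close>, with
  \<open>v\<close> a socle generator, kills \<open>q\<close> and sends \<open>r\<close> to
  \<open>v\<close>. Extended to \<open>R\<close>, it is multiplication into some \<open>w\<close>.
  With \<open>q = 0\<close> this says that \<open>M\<close> is faithful.\<close>

lemma separating_element:
  assumes q: "ideal q R" and r: "r \<in> carrier R" "r \<notin> q"
  obtains w where "w \<in> carrier M" "\<And>c. c \<in> q \<Longrightarrow> c \<odot>\<^bsub>M\<^esub> w = \<zero>\<^bsub>M\<^esub>" "r \<odot>\<^bsub>M\<^esub> w \<noteq> \<zero>\<^bsub>M\<^esub>"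
proof -
  interpret q: ideal q R by fact
  obtain v where v: "v \<in> carrier M" "v \<noteq> \<zero>\<^bsub>M\<^esub>" and zv: "\<And>z. z \<in> \<mm> \<Longrightarrow> z \<odot>\<^bsub>M\<^esub> v = \<zero>\<^bsub>M\<^esub>"
    by (rule socle_generator) blast
  define A where "A = q <+>\<^bsub>R\<^esub> PIdl r"
  have A: "ideal A R" unfolding A_def using q r by (rule R.add_cgenideal_strict(1))
  have A_iff: "a \<in> A \<longleftrightarrow> (\<exists>c\<in>q. \<exists>s\<in>carrier R. a = c \<oplus> s \<otimes> r)" for a
    unfolding A_def by (rule R.add_cgenideal_iff)
  \<comment> \<open>Well-definedness: two representations give \<open>(s - t) r\<close> in
    \<open>q\<close>. As \<open>r\<close> is not in \<open>q\<close>, the factor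
    \<open>s - t\<close> is no unit, so it lies in \<open>\<mm>\<close> and kills
    \<open>v\<close>.\<close>
  have wd: "s \<odot>\<^bsub>M\<^esub> v = t \<odot>\<^bsub>M\<^esub> v"
    if c: "c \<in> q" "d \<in> q" and st: "s \<in> carrier R" "t \<in> carrier R"
      and eq: "c \<oplus> s \<otimes> r = d \<oplus> t \<otimes> r" for c d s t
  proof -
    have cd: "c \<in> carrier R" "d \<in> carrier R" using c q.Icarr by auto
    have "(s \<ominus> t) \<otimes> r = (\<ominus> c \<oplus> (c \<oplus> s \<otimes> r)) \<oplus> \<ominus> (t \<otimes> r)"
      using cd st r(1) by (simp add: R.minus_eq R.l_distr R.l_minus R.r_neg1)
    also have "\<dots> = \<ominus> c \<oplus> d"
      unfolding eq using cd st r(1) by (simp add: R.a_assoc R.r_neg)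
    also have "\<dots> \<in> q" using c by (intro q.a_closed q.a_inv_closed)
    finally have "(s \<ominus> t) \<otimes> r \<in> q" .
    moreover have "s \<ominus> t \<in> carrier R" using st by simp
    ultimately have "s \<ominus> t \<in> \<mm>"
      using mult_unit_in_ideal[OF q, of "s \<ominus> t" r] r by blast
    then have "(s \<ominus> t) \<odot>\<^bsub>M\<^esub> v = \<zero>\<^bsub>M\<^esub>" by (rule zv)
    then have "s \<odot>\<^bsub>M\<^esub> v \<oplus>\<^bsub>M\<^esub> \<ominus>\<^bsub>M\<^esub> (t \<odot>\<^bsub>M\<^esub> v) = \<zero>\<^bsub>M\<^esub>"
      using st v(1) by (simp add: R.minus_eq M.smult_l_distr M.smult_l_minus)
    moreover have "s \<odot>\<^bsub>M\<^esub> v = (s \<odot>\<^bsub>M\<^esub> v \<oplus>\<^bsub>M\<^esub> \<ominus>\<^bsub>M\<^esub> (t \<odot>\<^bsub>M\<^esub> v)) \<oplus>\<^bsub>M\<^esub> t \<odot>\<^bsub>M\<^esub> v"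
      using st v(1) by (simp add: M.a_assoc M.l_neg)
    ultimately show ?thesis using st v(1) by simp
  qed
  define g where "g a = (SOME x. \<exists>c\<in>q. \<exists>s\<in>carrier R. a = c \<oplus> s \<otimes> r \<and> x = s \<odot>\<^bsub>M\<^esub> v)" for a
  have g: "g (c \<oplus> s \<otimes> r) = s \<odot>\<^bsub>M\<^esub> v" if c: "c \<in> q" "s \<in> carrier R" for c s
    unfolding g_def
  proof (rule some_equality)
    show "\<exists>d\<in>q. \<exists>t\<in>carrier R. c \<oplus> s \<otimes> r = d \<oplus> t \<otimes> r \<and> s \<odot>\<^bsub>M\<^esub> v = t \<odot>\<^bsub>M\<^esub> v"
      using c by blast
    fix x assume "\<exists>d\<in>q. \<exists>t\<in>carrier R. c \<oplus> s \<otimes> r = d \<oplus> t \<otimes> r \<and> x = t \<odot>\<^bsub>M\<^esub> v"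
    then show "x = s \<odot>\<^bsub>M\<^esub> v" using wd[OF c(1) _ c(2)] by metis
  qed
  obtain w where w: "w \<in> carrier M" "\<And>a. a \<in> A \<Longrightarrow> g a = a \<odot>\<^bsub>M\<^esub> w"
  proof (rule baer_extension[OF A])
    show "g \<in> A \<rightarrow> carrier M"
    proof (rule Pi_I)
      fix a assume "a \<in> A"
      then obtain c s where "c \<in> q" "s \<in> carrier R" "a = c \<oplus> s \<otimes> r" unfolding A_iff by blast
      then show "g a \<in> carrier M" using g v(1) by simp
    qed
    show "g (a \<oplus> b) = g a \<oplus>\<^bsub>M\<^esub> g b" if ab: "a \<in> A" "b \<in> A" for a b
    proof -
      obtain c s where cs: "c \<in> q" "s \<in> carrier R" "a = c \<oplus> s \<otimes> r"
        using ab(1) unfolding A_iff by blast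
      obtain d t where dt: "d \<in> q" "t \<in> carrier R" "b = d \<oplus> t \<otimes> r"
        using ab(2) unfolding A_iff by blast
      have "a \<oplus> b = (c \<oplus> d) \<oplus> (s \<oplus> t) \<otimes> r"
        using cs dt r(1) q.Icarr[OF cs(1)] q.Icarr[OF dt(1)] by (simp add: R.l_distr R.a_ac)
      then show ?thesis
        using g[OF q.a_closed[OF cs(1) dt(1)], of "s \<oplus> t"] g[OF cs(1,2)] g[OF dt(1,2)] cs dt v(1)
        by (simp add: M.smult_l_distr)
    qed
    show "g (x \<otimes> a) = x \<odot>\<^bsub>M\<^esub> g a" if xa: "x \<in> carrier R" "a \<in> A" for x a
    proof -
      obtain c s where cs: "c \<in> q" "s \<in> carrier R" "a = c \<oplus> s \<otimes> r"
        using xa(2) unfolding A_iff by blast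
      have "x \<otimes> a = x \<otimes> c \<oplus> (x \<otimes> s) \<otimes> r"
        using cs xa(1) r(1) q.Icarr[OF cs(1)] by (simp add: R.r_distr R.m_assoc)
      then show ?thesis
        using g[OF q.I_l_closed[OF cs(1) xa(1)], of "x \<otimes> s"] g[OF cs(1,2)] cs xa(1) v(1)
        by (simp add: M.smult_assoc1)
    qed
  qed blast
  have "g c = \<zero>\<^bsub>M\<^esub>" if c: "c \<in> q" for c
    using g[OF c R.zero_closed] q.Icarr[OF c] r(1) v(1) by simp
  moreover have "g r = v"
    using g[OF q.zero_closed R.one_closed] r(1) v(1) by simp
  moreover have "c \<in> A" if "c \<in> q" for c
    using R.add_cgenideal_strict(2)[OF q r] that unfolding A_def by blast
  moreover have "r \<in> A" unfolding A_def using q r by (rule R.add_cgenideal_strict(3))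
  ultimately show thesis using that[OF w(1)] w(2) v(2) by metis
qed

text \<open>Choose \<open>u\<close> in the socle of \<open>R/q\<close> and \<open>w\<close> killed
  by \<open>q\<close> but not by \<open>u\<close>. If the annihilator of \<open>w\<close> were
  strictly larger than \<open>q\<close>, irreducibility would force it to contain
  \<open>u\<close>.\<close>

lemma irreducible_annihilator:
  assumes "irreducible_ideal R q"
  obtains w where "w \<in> carrier M" "\<And>c. c \<in> carrier R \<Longrightarrow> c \<odot>\<^bsub>M\<^esub> w = \<zero>\<^bsub>M\<^esub> \<longleftrightarrow> c \<in> q"
proof -
  have q: "ideal q R" "q \<noteq> carrier R" using assms by (auto simp: irreducible_ideal_def)
  obtain u where u: "u \<in> carrier R" "u \<notin> q" "\<And>z. z \<in> \<mm> \<Longrightarrow> z \<otimes> u \<in> q"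
    by (rule exists_socle_element[OF q]) blast
  obtain w where w: "w \<in> carrier M" "\<And>c. c \<in> q \<Longrightarrow> c \<odot>\<^bsub>M\<^esub> w = \<zero>\<^bsub>M\<^esub>" "u \<odot>\<^bsub>M\<^esub> w \<noteq> \<zero>\<^bsub>M\<^esub>"
    by (rule separating_element[OF q(1) u(1,2)]) blast
  have A: "ideal (annih {w}) R" using w(1) by (intro annih_ideal) simp
  have "q \<subseteq> annih {w}" using w(2) ideal.Icarr[OF q(1)] by (auto simp: annih_def)
  moreover have "u \<notin> annih {w}" using w(3) by (simp add: annih_def)
  ultimately have "annih {w} = q"
    using irreducible_ideal_in_larger[OF assms u A] by blast
  then have "c \<odot>\<^bsub>M\<^esub> w = \<zero>\<^bsub>M\<^esub> \<longleftrightarrow> c \<in> q" if "c \<in> carrier R" for c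
    using that by (auto simp: annih_def)
  with w(1) that show thesis by blast
qed

section \<open>Homomorphisms from \<open>M\<close> to \<open>R\<close>, and the trace ideal\<close>

lemma dual_hom:
  assumes "f \<in> module_dual R M"
  shows "x \<in> carrier M \<Longrightarrow> f x \<in> carrier R"
    and "x \<in> carrier M \<Longrightarrow> y \<in> carrier M \<Longrightarrow> f (x \<oplus>\<^bsub>M\<^esub> y) = f x \<oplus> f y"
    and "c \<in> carrier R \<Longrightarrow> x \<in> carrier M \<Longrightarrow> f (c \<odot>\<^bsub>M\<^esub> x) = c \<otimes> f x"
  using assms by (auto simp: module_dual_def module_hom_def self_module_simps)

lemma dual_hom_zero:
  assumes "f \<in> module_dual R M"
  shows "f \<zero>\<^bsub>M\<^esub> = \<zero>"
  using dual_hom(3)[OF assms R.zero_closed M.zero_closed] dual_hom(1)[OF assms M.zero_closed] by simp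

lemma trace_generators_subset:
  "{f x |f x. f \<in> module_dual R M \<and> x \<in> carrier M} \<subseteq> carrier R"
  using dual_hom(1) by blast

text \<open>For each \<open>f\<close> the inverse image \<open>N\<close> of \<open>\<aa>\<close> is
  a submodule, and the double annihilator property places \<open>y x\<close> in it. Hence
  \<open>y\<close> multiplies every generator of the trace into \<open>\<aa>\<close>, and therefore
  all of \<open>\<mm>\<close>.\<close>

lemma trace_implies_colon:
  assumes trace: "\<mm> \<subseteq> trace_ideal R M" and a: "ideal \<aa> R"
  shows "ideal_colon R {\<zero>} (ideal_colon R {\<zero>} \<aa>) \<subseteq> ideal_colon R \<aa> \<mm>"
proof (rule subsetI)
  interpret a: ideal \<aa> R by fact
  fix y assume y: "y \<in> ideal_colon R {\<zero>} (ideal_colon R {\<zero>} \<aa>)"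
  then have yR: "y \<in> carrier R" by (simp add: ideal_colon_def)
  have "y \<otimes> f x \<in> \<aa>" if f: "f \<in> module_dual R M" and x: "x \<in> carrier M" for f x
  proof -
    define N where "N = {x \<in> carrier M. f x \<in> \<aa>}"
    have N: "submodule R N M"
      using a.zero_closed dual_hom_zero[OF f]
      by (intro submodule_of_closed) (auto simp: N_def dual_hom[OF f] a.I_l_closed)
    \<comment> \<open>\<open>N\<close> contains \<open>\<aa> M\<close>, so by faithfulness \<open>ann N\<close> lies in \<open>0 : \<aa>\<close>.\<close>
    have "y \<odot>\<^bsub>M\<^esub> x \<in> N"
    proof (rule double_annihilator[OF N])
      show "y \<odot>\<^bsub>M\<^esub> x \<in> carrier M" using yR x by simp
      fix c assume c: "c \<in> annih N"
      then have cR: "c \<in> carrier R" by (simp add: annih_def)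
      have "c \<otimes> d = \<zero>" if d: "d \<in> \<aa>" for d
      proof (rule ccontr)
        assume "c \<otimes> d \<noteq> \<zero>"
        moreover have dR: "d \<in> carrier R" using d by (rule a.Icarr)
        ultimately obtain w where w: "w \<in> carrier M" "(c \<otimes> d) \<odot>\<^bsub>M\<^esub> w \<noteq> \<zero>\<^bsub>M\<^esub>"
          using cR by (auto intro: separating_element[OF R.zeroideal, of "c \<otimes> d"])
        have "d \<odot>\<^bsub>M\<^esub> w \<in> N"
          using d dR w(1) a.I_r_closed dual_hom[OF f] by (simp add: N_def)
        then have "c \<odot>\<^bsub>M\<^esub> (d \<odot>\<^bsub>M\<^esub> w) = \<zero>\<^bsub>M\<^esub>" using c by (simp add: annih_def)
        with w cR dR show False by (simp add: M.smult_assoc1)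
      qed
      then have "c \<in> ideal_colon R {\<zero>} \<aa>" using cR by (simp add: ideal_colon_def)
      then have "c \<otimes> y = \<zero>" using y cR yR by (simp add: ideal_colon_def R.m_comm)
      then show "c \<odot>\<^bsub>M\<^esub> (y \<odot>\<^bsub>M\<^esub> x) = \<zero>\<^bsub>M\<^esub>"
        using cR yR x by (simp flip: M.smult_assoc1)
    qed
    then show ?thesis using dual_hom(3)[OF f yR x] by (simp add: N_def)
  qed
  then have "trace_ideal R M \<subseteq> {z \<in> carrier R. y \<otimes> z \<in> \<aa>}"
    unfolding trace_ideal_def
    using R.ideal_mult_vimage[OF a yR] trace_generators_subset
    by (intro R.genideal_minimal) (auto simp: dual_hom(1))
  with trace show "y \<in> ideal_colon R \<aa> \<mm>" using yR by (auto simp: ideal_colon_def)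
qed

end

section \<open>The trace of the canonical module\<close>

text \<open>Irreducibility is encoded by elements of \<open>M\<close> whose annihilators are exactly
  the two ideals. The data are symmetric in the two indices, so statements proved for one index
  carry over to the other.\<close>

locale irreducible_pair = artinian_canonical R \<mm> M
  for R :: "('a, 'c) ring_scheme" (structure) and \<mm> and M :: "('a, 'w, 'd) module_scheme" +
  fixes q\<^sub>1 q\<^sub>2 w\<^sub>1 w\<^sub>2
  assumes ideal1: "ideal q\<^sub>1 R" and ideal2: "ideal q\<^sub>2 R" and inter: "q\<^sub>1 \<inter> q\<^sub>2 = {\<zero>}"
    and w1: "w\<^sub>1 \<in> carrier M" "\<And>c. c \<in> carrier R \<Longrightarrow> c \<odot>\<^bsub>M\<^esub> w\<^sub>1 = \<zero>\<^bsub>M\<^esub> \<longleftrightarrow> c \<in> q\<^sub>1"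
    and w2: "w\<^sub>2 \<in> carrier M" "\<And>c. c \<in> carrier R \<Longrightarrow> c \<odot>\<^bsub>M\<^esub> w\<^sub>2 = \<zero>\<^bsub>M\<^esub> \<longleftrightarrow> c \<in> q\<^sub>2"
begin

abbreviation (input) b\<^sub>1 where "b\<^sub>1 \<equiv> ideal_colon R {\<zero>} q\<^sub>1"
abbreviation (input) b\<^sub>2 where "b\<^sub>2 \<equiv> ideal_colon R {\<zero>} q\<^sub>2"

lemma swap: "irreducible_pair R \<mm> M q\<^sub>2 q\<^sub>1 w\<^sub>2 w\<^sub>1"
  using ideal1 ideal2 inter w1 w2
  by (intro irreducible_pair.intro irreducible_pair_axioms.intro artinian_canonical_axioms) auto

lemma q_carrier: "q\<^sub>1 \<subseteq> carrier R" "q\<^sub>2 \<subseteq> carrier R"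
  using ideal.Icarr[OF ideal1] ideal.Icarr[OF ideal2] by auto

lemma b_ideal: "ideal b\<^sub>1 R" "ideal b\<^sub>2 R"
  using q_carrier R.zeroideal by (auto intro: R.ideal_colon_ideal)

text \<open>Such a \<open>c\<close> lies in \<open>q\<^sub>1 \<inter> q\<^sub>2\<close>. Equations
  in \<open>R\<close> can thus be checked on the two elements \<open>w\<^sub>1\<close> and
  \<open>w\<^sub>2\<close>.\<close>

lemma zero_if_kills:
  assumes "c \<in> carrier R" "c \<odot>\<^bsub>M\<^esub> w\<^sub>1 = \<zero>\<^bsub>M\<^esub>" "c \<odot>\<^bsub>M\<^esub> w\<^sub>2 = \<zero>\<^bsub>M\<^esub>"
  shows "c = \<zero>"
  using assms w1(2) w2(2) inter by auto

lemma in_b1_iff: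
  "r \<in> b\<^sub>1 \<longleftrightarrow> r \<in> carrier R \<and> (\<forall>c\<in>q\<^sub>1. c \<otimes> r = \<zero>)"
  using q_carrier(1) by (auto simp: ideal_colon_def R.m_comm subset_iff)

text \<open>The submodule spanned by \<open>w\<^sub>1\<close> and \<open>w\<^sub>2\<close> has zero
  annihilator, so the double annihilator property makes it all of \<open>M\<close>.\<close>

lemma generators:
  assumes "x \<in> carrier M"
  obtains s t where "s \<in> carrier R" "t \<in> carrier R" "x = s \<odot>\<^bsub>M\<^esub> w\<^sub>1 \<oplus>\<^bsub>M\<^esub> t \<odot>\<^bsub>M\<^esub> w\<^sub>2"
proof -
  define N where "N = {s \<odot>\<^bsub>M\<^esub> w\<^sub>1 \<oplus>\<^bsub>M\<^esub> t \<odot>\<^bsub>M\<^esub> w\<^sub>2 |s t. s \<in> carrier R \<and> t \<in> carrier R}"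
  have N: "submodule R N M"
  proof (rule submodule_of_closed)
    have "\<zero>\<^bsub>M\<^esub> = \<zero> \<odot>\<^bsub>M\<^esub> w\<^sub>1 \<oplus>\<^bsub>M\<^esub> \<zero> \<odot>\<^bsub>M\<^esub> w\<^sub>2" using w1(1) w2(1) by simp
    then show "\<zero>\<^bsub>M\<^esub> \<in> N" unfolding N_def by blast
    fix x y assume "x \<in> N" "y \<in> N"
    then obtain s t s' t' where "s \<in> carrier R" "t \<in> carrier R" "s' \<in> carrier R" "t' \<in> carrier R"
      "x = s \<odot>\<^bsub>M\<^esub> w\<^sub>1 \<oplus>\<^bsub>M\<^esub> t \<odot>\<^bsub>M\<^esub> w\<^sub>2" "y = s' \<odot>\<^bsub>M\<^esub> w\<^sub>1 \<oplus>\<^bsub>M\<^esub> t' \<odot>\<^bsub>M\<^esub> w\<^sub>2"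
      unfolding N_def by blast
    then have "x \<oplus>\<^bsub>M\<^esub> y = (s \<oplus> s') \<odot>\<^bsub>M\<^esub> w\<^sub>1 \<oplus>\<^bsub>M\<^esub> (t \<oplus> t') \<odot>\<^bsub>M\<^esub> w\<^sub>2" "s \<oplus> s' \<in> carrier R" "t \<oplus> t' \<in> carrier R"
      using w1(1) w2(1) by (simp_all add: M.smult_l_distr M.a_ac)
    then show "x \<oplus>\<^bsub>M\<^esub> y \<in> N" unfolding N_def by blast
  next
    fix c x assume c: "c \<in> carrier R" and "x \<in> N"
    then obtain s t where "s \<in> carrier R" "t \<in> carrier R"
      "x = s \<odot>\<^bsub>M\<^esub> w\<^sub>1 \<oplus>\<^bsub>M\<^esub> t \<odot>\<^bsub>M\<^esub> w\<^sub>2"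
      unfolding N_def by blast
    then have "c \<odot>\<^bsub>M\<^esub> x = (c \<otimes> s) \<odot>\<^bsub>M\<^esub> w\<^sub>1 \<oplus>\<^bsub>M\<^esub> (c \<otimes> t) \<odot>\<^bsub>M\<^esub> w\<^sub>2" "c \<otimes> s \<in> carrier R" "c \<otimes> t \<in> carrier R"
      using c w1(1) w2(1) by (simp_all add: M.smult_r_distr M.smult_assoc1)
    then show "c \<odot>\<^bsub>M\<^esub> x \<in> N" unfolding N_def by blast
  qed (use w1(1) w2(1) in \<open>auto simp: N_def\<close>)
  have "w\<^sub>1 = \<one> \<odot>\<^bsub>M\<^esub> w\<^sub>1 \<oplus>\<^bsub>M\<^esub> \<zero> \<odot>\<^bsub>M\<^esub> w\<^sub>2" "w\<^sub>2 = \<zero> \<odot>\<^bsub>M\<^esub> w\<^sub>1 \<oplus>\<^bsub>M\<^esub> \<one> \<odot>\<^bsub>M\<^esub> w\<^sub>2"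
    using w1(1) w2(1) by simp_all
  then have "w\<^sub>1 \<in> N" "w\<^sub>2 \<in> N" unfolding N_def using R.one_closed R.zero_closed by blast+
  have "x \<in> N"
  proof (rule double_annihilator[OF N assms])
    fix c assume "c \<in> annih N"
    then have "c \<in> carrier R" "c \<odot>\<^bsub>M\<^esub> w\<^sub>1 = \<zero>\<^bsub>M\<^esub>" "c \<odot>\<^bsub>M\<^esub> w\<^sub>2 = \<zero>\<^bsub>M\<^esub>"
      using \<open>w\<^sub>1 \<in> N\<close> \<open>w\<^sub>2 \<in> N\<close> by (auto simp: annih_def)
    then have "c = \<zero>" by (rule zero_if_kills)
    then show "c \<odot>\<^bsub>M\<^esub> x = \<zero>\<^bsub>M\<^esub>" using assms by simp
  qed
  then show thesis using that unfolding N_def by blast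
qed

text \<open>The annihilator of \<open>R w\<^sub>1\<close> is \<open>q\<^sub>1\<close>, which kills
  \<open>r w\<^sub>2\<close>; by the double annihilator property \<open>r w\<^sub>2\<close> lies in
  \<open>R w\<^sub>1\<close>. For \<open>c\<close> in \<open>q\<^sub>2\<close>, the product
  \<open>a c\<close> kills \<open>w\<^sub>2\<close>, and also \<open>w\<^sub>1\<close> because
  \<open>c a w\<^sub>1 = r c w\<^sub>2 = 0\<close>.\<close>

lemma exchange:
  assumes r: "r \<in> b\<^sub>1"
  obtains a where "a \<in> b\<^sub>2" "r \<odot>\<^bsub>M\<^esub> w\<^sub>2 = a \<odot>\<^bsub>M\<^esub> w\<^sub>1"
proof -
  have rR: "r \<in> carrier R" using r by (simp add: in_b1_iff)
  have "r \<odot>\<^bsub>M\<^esub> w\<^sub>2 \<in> (\<lambda>t. t \<odot>\<^bsub>M\<^esub> w\<^sub>1) ` carrier R"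
  proof (rule double_annihilator[OF multiples_submodule[OF R.oneideal w1(1)]])
    show "r \<odot>\<^bsub>M\<^esub> w\<^sub>2 \<in> carrier M" using rR w2(1) by simp
    fix c assume c: "c \<in> annih ((\<lambda>t. t \<odot>\<^bsub>M\<^esub> w\<^sub>1) ` carrier R)"
    then have cR: "c \<in> carrier R" by (simp add: annih_def)
    have "c \<odot>\<^bsub>M\<^esub> (\<one> \<odot>\<^bsub>M\<^esub> w\<^sub>1) = \<zero>\<^bsub>M\<^esub>" using c R.one_closed unfolding annih_def by blast
    then have "c \<in> q\<^sub>1" using w1 cR by simp
    then have "c \<otimes> r = \<zero>" using r by (simp add: in_b1_iff)
    then show "c \<odot>\<^bsub>M\<^esub> (r \<odot>\<^bsub>M\<^esub> w\<^sub>2) = \<zero>\<^bsub>M\<^esub>" using cR rR w2(1) by (simp flip: M.smult_assoc1)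
  qed
  then obtain a where a: "a \<in> carrier R" "r \<odot>\<^bsub>M\<^esub> w\<^sub>2 = a \<odot>\<^bsub>M\<^esub> w\<^sub>1" by blast
  have "a \<otimes> c = \<zero>" if c: "c \<in> q\<^sub>2" for c
  proof (rule zero_if_kills)
    have cR: "c \<in> carrier R" using c q_carrier by blast
    then show "a \<otimes> c \<in> carrier R" using a(1) by simp
    have cw: "c \<odot>\<^bsub>M\<^esub> w\<^sub>2 = \<zero>\<^bsub>M\<^esub>" using w2(2)[OF cR] c by simp
    then show "(a \<otimes> c) \<odot>\<^bsub>M\<^esub> w\<^sub>2 = \<zero>\<^bsub>M\<^esub>" using a(1) cR w2(1) by (simp add: M.smult_assoc1)
    have "(a \<otimes> c) \<odot>\<^bsub>M\<^esub> w\<^sub>1 = c \<odot>\<^bsub>M\<^esub> (a \<odot>\<^bsub>M\<^esub> w\<^sub>1)"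
      using M.smult_assoc1[OF cR a(1) w1(1)] R.m_comm[OF cR a(1)] by simp
    also have "\<dots> = r \<odot>\<^bsub>M\<^esub> (c \<odot>\<^bsub>M\<^esub> w\<^sub>2)" unfolding a(2)[symmetric] using cR rR w2(1) by (rule smult_comm)
    also have "\<dots> = \<zero>\<^bsub>M\<^esub>" using cw rR by simp
    finally show "(a \<otimes> c) \<odot>\<^bsub>M\<^esub> w\<^sub>1 = \<zero>\<^bsub>M\<^esub>" .
  qed
  then have "a \<in> b\<^sub>2" using a(1) by (simp add: ideal_colon_def)
  with a(2) that show thesis by blast
qed

text \<open>A homomorphism taking the value \<open>r\<close> at \<open>w\<^sub>1\<close> is
  constructed; its value at \<open>w\<^sub>2\<close> is the element \<open>a\<close> supplied by
  \<open>exchange\<close>.\<close>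

lemma b1_subset_trace: "b\<^sub>1 \<subseteq> trace_ideal R M"
proof (rule subsetI)
  fix r assume r: "r \<in> b\<^sub>1"
  then have rR: "r \<in> carrier R" by (simp add: in_b1_iff)
  obtain a where "a \<in> b\<^sub>2" and ra: "r \<odot>\<^bsub>M\<^esub> w\<^sub>2 = a \<odot>\<^bsub>M\<^esub> w\<^sub>1" using r by (rule exchange)
  then have aR: "a \<in> carrier R" by (simp add: ideal_colon_def)
  let ?x = "\<lambda>s t. s \<odot>\<^bsub>M\<^esub> w\<^sub>1 \<oplus>\<^bsub>M\<^esub> t \<odot>\<^bsub>M\<^esub> w\<^sub>2"
  \<comment> \<open>The intended value at \<open>x\<close> acts on \<open>w\<^sub>1\<close> as
    \<open>r x\<close> and on \<open>w\<^sub>2\<close> as \<open>a x\<close>. These products depend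
    on \<open>x\<close> alone, not on the coefficients \<open>s\<close> and \<open>t\<close>, which
    yields well-definedness.\<close>
  have mult1: "(s \<otimes> r \<oplus> t \<otimes> a) \<odot>\<^bsub>M\<^esub> w\<^sub>1 = r \<odot>\<^bsub>M\<^esub> ?x s t"
    if "s \<in> carrier R" "t \<in> carrier R" for s t
  proof -
    have "(s \<otimes> r \<oplus> t \<otimes> a) \<odot>\<^bsub>M\<^esub> w\<^sub>1 = s \<odot>\<^bsub>M\<^esub> (r \<odot>\<^bsub>M\<^esub> w\<^sub>1) \<oplus>\<^bsub>M\<^esub> t \<odot>\<^bsub>M\<^esub> (r \<odot>\<^bsub>M\<^esub> w\<^sub>2)"
      unfolding ra using that rR aR w1(1) by (simp add: M.smult_l_distr M.smult_assoc1)
    also have "\<dots> = r \<odot>\<^bsub>M\<^esub> ?x s t"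
      using that rR w1(1) w2(1) smult_comm[OF rR that(1) w1(1)] smult_comm[OF rR that(2) w2(1)]
      by (simp add: M.smult_r_distr)
    finally show ?thesis .
  qed
  have mult2: "(s \<otimes> r \<oplus> t \<otimes> a) \<odot>\<^bsub>M\<^esub> w\<^sub>2 = a \<odot>\<^bsub>M\<^esub> ?x s t"
    if "s \<in> carrier R" "t \<in> carrier R" for s t
  proof -
    have "(s \<otimes> r \<oplus> t \<otimes> a) \<odot>\<^bsub>M\<^esub> w\<^sub>2 = s \<odot>\<^bsub>M\<^esub> (r \<odot>\<^bsub>M\<^esub> w\<^sub>2) \<oplus>\<^bsub>M\<^esub> t \<odot>\<^bsub>M\<^esub> (a \<odot>\<^bsub>M\<^esub> w\<^sub>2)"
      using that rR aR w2(1) by (simp add: M.smult_l_distr M.smult_assoc1)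
    also have "\<dots> = a \<odot>\<^bsub>M\<^esub> ?x s t"
      unfolding ra
      using that aR w1(1) w2(1) smult_comm[OF aR that(1) w1(1)] smult_comm[OF aR that(2) w2(1)]
      by (simp add: M.smult_r_distr)
    finally show ?thesis .
  qed
  have wd: "s \<otimes> r \<oplus> t \<otimes> a = s' \<otimes> r \<oplus> t' \<otimes> a"
    if st: "s \<in> carrier R" "t \<in> carrier R" "s' \<in> carrier R" "t' \<in> carrier R"
      and eq: "?x s t = ?x s' t'" for s t s' t'
  proof -
    define d where "d = s \<otimes> r \<oplus> t \<otimes> a"
    define d' where "d' = s' \<otimes> r \<oplus> t' \<otimes> a"
    have dR: "d \<in> carrier R" "d' \<in> carrier R" using st rR aR by (auto simp: d_def d'_def)
    have "d \<odot>\<^bsub>M\<^esub> w\<^sub>1 = d' \<odot>\<^bsub>M\<^esub> w\<^sub>1" "d \<odot>\<^bsub>M\<^esub> w\<^sub>2 = d' \<odot>\<^bsub>M\<^esub> w\<^sub>2"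
      unfolding d_def d'_def using mult1 mult2 st eq by simp_all
    then have "d \<ominus> d' = \<zero>"
      using dR w1(1) w2(1)
      by (intro zero_if_kills) (simp_all add: R.minus_eq M.smult_l_distr M.smult_l_minus M.r_neg)
    then show ?thesis using dR unfolding d_def[symmetric] d'_def[symmetric] by simp
  qed
  define f where "f x = (SOME y. \<exists>s\<in>carrier R. \<exists>t\<in>carrier R. x = ?x s t \<and> y = s \<otimes> r \<oplus> t \<otimes> a)" for x
  have f: "f (?x s t) = s \<otimes> r \<oplus> t \<otimes> a" if st: "s \<in> carrier R" "t \<in> carrier R" for s t
    unfolding f_def
  proof (rule some_equality)
    show "\<exists>s'\<in>carrier R. \<exists>t'\<in>carrier R. ?x s t = ?x s' t' \<and> s \<otimes> r \<oplus> t \<otimes> a = s' \<otimes> r \<oplus> t' \<otimes> a"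
      using st by blast
    fix y assume "\<exists>s'\<in>carrier R. \<exists>t'\<in>carrier R. ?x s t = ?x s' t' \<and> y = s' \<otimes> r \<oplus> t' \<otimes> a"
    then show "y = s \<otimes> r \<oplus> t \<otimes> a" using wd[OF st] by metis
  qed
  have "f x \<in> carrier R" if x: "x \<in> carrier M" for x
  proof -
    obtain s t where "s \<in> carrier R" "t \<in> carrier R" "x = ?x s t" using x by (rule generators)
    then show ?thesis using f rR aR by simp
  qed
  moreover have "f (x \<oplus>\<^bsub>M\<^esub> y) = f x \<oplus> f y" if xy: "x \<in> carrier M" "y \<in> carrier M" for x y
  proof -
    obtain s t where st: "s \<in> carrier R" "t \<in> carrier R" "x = ?x s t" using xy(1) by (rule generators)
    obtain s' t' where st': "s' \<in> carrier R" "t' \<in> carrier R" "y = ?x s' t'" using xy(2) by (rule generators)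
    have "x \<oplus>\<^bsub>M\<^esub> y = ?x (s \<oplus> s') (t \<oplus> t')"
      using st st' w1(1) w2(1) by (simp add: M.smult_l_distr M.a_ac)
    then show ?thesis
      using f[of "s \<oplus> s'" "t \<oplus> t'"] f[OF st(1,2)] f[OF st'(1,2)] st st' rR aR
      by (simp add: R.l_distr R.a_ac)
  qed
  moreover have "f (c \<odot>\<^bsub>M\<^esub> x) = c \<otimes> f x" if cx: "c \<in> carrier R" "x \<in> carrier M" for c x
  proof -
    obtain s t where st: "s \<in> carrier R" "t \<in> carrier R" "x = ?x s t" using cx(2) by (rule generators)
    have "c \<odot>\<^bsub>M\<^esub> x = ?x (c \<otimes> s) (c \<otimes> t)"
      using st cx(1) w1(1) w2(1) by (simp add: M.smult_r_distr M.smult_assoc1)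
    then show ?thesis
      using f[of "c \<otimes> s" "c \<otimes> t"] f[OF st(1,2)] st cx(1) rR aR
      by (simp add: R.r_distr R.m_assoc)
  qed
  ultimately have "f \<in> module_dual R M"
    by (auto simp: module_dual_def module_hom_def self_module_simps)
  moreover have "f w\<^sub>1 = r"
    using f[OF R.one_closed R.zero_closed] w1(1) w2(1) rR aR by simp
  ultimately show "r \<in> trace_ideal R M"
    unfolding trace_ideal_def using w1(1) R.genideal_self[OF trace_generators_subset] by blast
qed

text \<open>One inclusion is the preceding construction for both indices. For the other,
  \<open>f x\<close> is a combination of \<open>f w\<^sub>1\<close> and \<open>f w\<^sub>2\<close>,
  and each \<open>f w\<^sub>i\<close> inherits the annihilation by \<open>q\<^sub>i\<close>.\<close>

lemma trace_eq: "trace_ideal R M = b\<^sub>1 <+>\<^bsub>R\<^esub> b\<^sub>2"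
proof
  interpret T: ideal "trace_ideal R M" R
    unfolding trace_ideal_def using trace_generators_subset by (rule R.genideal_ideal)
  have "b\<^sub>1 \<subseteq> trace_ideal R M" "b\<^sub>2 \<subseteq> trace_ideal R M"
    using b1_subset_trace irreducible_pair.b1_subset_trace[OF swap] by auto
  then show "b\<^sub>1 <+>\<^bsub>R\<^esub> b\<^sub>2 \<subseteq> trace_ideal R M"
    using T.a_closed by (auto simp: set_add_def')
  have B: "ideal (b\<^sub>1 <+>\<^bsub>R\<^esub> b\<^sub>2) R" using b_ideal by (rule R.add_ideals)
  show "trace_ideal R M \<subseteq> b\<^sub>1 <+>\<^bsub>R\<^esub> b\<^sub>2"
    unfolding trace_ideal_def
  proof (rule R.genideal_minimal[OF B], clarify)
    fix f x assume f: "f \<in> module_dual R M" and x: "x \<in> carrier M"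
    obtain s t where st: "s \<in> carrier R" "t \<in> carrier R" "x = s \<odot>\<^bsub>M\<^esub> w\<^sub>1 \<oplus>\<^bsub>M\<^esub> t \<odot>\<^bsub>M\<^esub> w\<^sub>2"
      using x by (rule generators)
    have fw: "f w\<^sub>1 \<in> carrier R" "f w\<^sub>2 \<in> carrier R" using dual_hom(1)[OF f] w1(1) w2(1) by auto
    have "f w\<^sub>1 \<otimes> c = \<zero>" if c: "c \<in> q\<^sub>1" for c
    proof -
      have cR: "c \<in> carrier R" using c q_carrier by blast
      then have "c \<otimes> f w\<^sub>1 = \<zero>"
        using dual_hom(3)[OF f cR w1(1)] w1(2)[OF cR] c dual_hom_zero[OF f] by simp
      then show ?thesis using cR fw by (simp add: R.m_comm)
    qed
    then have "f w\<^sub>1 \<in> b\<^sub>1" using fw by (simp add: ideal_colon_def)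
    moreover have "f w\<^sub>2 \<otimes> c = \<zero>" if c: "c \<in> q\<^sub>2" for c
    proof -
      have cR: "c \<in> carrier R" using c q_carrier by blast
      then have "c \<otimes> f w\<^sub>2 = \<zero>"
        using dual_hom(3)[OF f cR w2(1)] w2(2)[OF cR] c dual_hom_zero[OF f] by simp
      then show ?thesis using cR fw by (simp add: R.m_comm)
    qed
    then have "f w\<^sub>2 \<in> b\<^sub>2" using fw by (simp add: ideal_colon_def)
    moreover have "f x = s \<otimes> f w\<^sub>1 \<oplus> t \<otimes> f w\<^sub>2"
      using st dual_hom[OF f] w1(1) w2(1) by simp
    ultimately show "f x \<in> b\<^sub>1 <+>\<^bsub>R\<^esub> b\<^sub>2"
      using ideal.I_l_closed[OF b_ideal(1) _ st(1)] ideal.I_l_closed[OF b_ideal(2) _ st(2)]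
      by (auto simp: set_add_def')
  qed
qed

text \<open>The hypothesis is the colon condition for the single ideal \<open>q\<^sub>1\<close>.
  Duality yields \<open>z w\<^sub>1 = t w\<^sub>1\<close> with \<open>t\<close> in the sum, and the
  error \<open>z - t\<close> lies in \<open>q\<^sub>1\<close>, which is contained in
  \<open>b\<^sub>2\<close>.\<close>

lemma colon_implies_sum:
  assumes "ideal_colon R {\<zero>} b\<^sub>1 \<subseteq> ideal_colon R q\<^sub>1 \<mm>"
  shows "\<mm> \<subseteq> b\<^sub>1 <+>\<^bsub>R\<^esub> b\<^sub>2"
proof (rule subsetI)
  define B where "B = b\<^sub>1 <+>\<^bsub>R\<^esub> b\<^sub>2"
  interpret b1: ideal b\<^sub>1 R by (rule b_ideal)
  interpret b2: ideal b\<^sub>2 R by (rule b_ideal)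
  interpret B: ideal B R unfolding B_def using b_ideal by (rule R.add_ideals)
  have bB: "b\<^sub>1 \<subseteq> B" "b\<^sub>2 \<subseteq> B"
  proof -
    have "x = x \<oplus> \<zero>" if "x \<in> b\<^sub>1" for x using b1.Icarr[OF that] by simp
    then show "b\<^sub>1 \<subseteq> B" unfolding B_def set_add_def' using b2.zero_closed by blast
    have "x = \<zero> \<oplus> x" if "x \<in> b\<^sub>2" for x using b2.Icarr[OF that] by simp
    then show "b\<^sub>2 \<subseteq> B" unfolding B_def set_add_def' using b1.zero_closed by blast
  qed
  let ?N = "(\<lambda>t. t \<odot>\<^bsub>M\<^esub> w\<^sub>1) ` B"
  fix z assume z: "z \<in> \<mm>"
  have zR: "z \<in> carrier R" using z by (rule maximal.Icarr)
  have "z \<odot>\<^bsub>M\<^esub> w\<^sub>1 \<in> ?N"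
  proof (rule double_annihilator[OF multiples_submodule[OF B.is_ideal w1(1)]])
    show "z \<odot>\<^bsub>M\<^esub> w\<^sub>1 \<in> carrier M" using zR w1(1) by simp
    fix y assume y: "y \<in> annih ?N"
    then have yR: "y \<in> carrier R" by (simp add: annih_def)
    have kill: "y \<odot>\<^bsub>M\<^esub> (t \<odot>\<^bsub>M\<^esub> w\<^sub>1) = \<zero>\<^bsub>M\<^esub>" if "t \<in> B" for t
      using y that by (simp add: annih_def)
    \<comment> \<open>Killing \<open>b\<^sub>1 w\<^sub>1\<close> handles \<open>w\<^sub>1\<close>.
      For \<open>w\<^sub>2\<close>, the exchange \<open>t w\<^sub>2 = s w\<^sub>1\<close> with
      \<open>s\<close> in \<open>b\<^sub>2\<close> uses the other summand of
      \<open>B\<close>.\<close>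
    have yt: "y \<otimes> t = \<zero>" if t: "t \<in> b\<^sub>1" for t
    proof (rule zero_if_kills)
      have tR: "t \<in> carrier R" using t by (rule b1.Icarr)
      then show "y \<otimes> t \<in> carrier R" using yR by simp
      show "(y \<otimes> t) \<odot>\<^bsub>M\<^esub> w\<^sub>1 = \<zero>\<^bsub>M\<^esub>"
        using kill[OF subsetD[OF bB(1) t]] M.smult_assoc1[OF yR tR w1(1)] by simp
      obtain s where s: "s \<in> b\<^sub>2" "t \<odot>\<^bsub>M\<^esub> w\<^sub>2 = s \<odot>\<^bsub>M\<^esub> w\<^sub>1" using t by (rule exchange)
      show "(y \<otimes> t) \<odot>\<^bsub>M\<^esub> w\<^sub>2 = \<zero>\<^bsub>M\<^esub>"
        using kill[OF subsetD[OF bB(2) s(1)]] M.smult_assoc1[OF yR tR w2(1)] s(2) by simp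
    qed
    have "y \<in> ideal_colon R {\<zero>} b\<^sub>1"
    proof (rule ideal_colonI[OF yR])
      fix t assume "t \<in> b\<^sub>1"
      then have "y \<otimes> t = \<zero>" by (rule yt)
      then show "y \<otimes> t \<in> {\<zero>}" by (rule ssubst) (rule singletonI)
    qed
    then have "y \<otimes> z \<in> q\<^sub>1" using ideal_colonD(2)[OF subsetD[OF assms]] z by blast
    then have "(y \<otimes> z) \<odot>\<^bsub>M\<^esub> w\<^sub>1 = \<zero>\<^bsub>M\<^esub>" using w1(2)[OF R.m_closed[OF yR zR]] by simp
    then show "y \<odot>\<^bsub>M\<^esub> (z \<odot>\<^bsub>M\<^esub> w\<^sub>1) = \<zero>\<^bsub>M\<^esub>"
      using M.smult_assoc1[OF yR zR w1(1)] by simp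
  qed
  then obtain t where t: "t \<in> B" "z \<odot>\<^bsub>M\<^esub> w\<^sub>1 = t \<odot>\<^bsub>M\<^esub> w\<^sub>1" by blast
  have tR: "t \<in> carrier R" using t(1) by (rule B.Icarr)
  have "(z \<ominus> t) \<odot>\<^bsub>M\<^esub> w\<^sub>1 = \<zero>\<^bsub>M\<^esub>"
    using t(2) zR tR w1(1) by (simp add: R.minus_eq M.smult_l_distr M.smult_l_minus M.r_neg)
  then have d: "z \<ominus> t \<in> q\<^sub>1" using w1(2)[of "z \<ominus> t"] zR tR by simp
  \<comment> \<open>The product lies in both ideals, whose intersection is zero.\<close>
  have "(z \<ominus> t) \<otimes> c = \<zero>" if c: "c \<in> q\<^sub>2" for c
  proof -
    have "c \<in> carrier R" "z \<ominus> t \<in> carrier R" using c q_carrier zR tR by auto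
    then have "(z \<ominus> t) \<otimes> c \<in> q\<^sub>1 \<inter> q\<^sub>2"
      using ideal.I_r_closed[OF ideal1 d] ideal.I_l_closed[OF ideal2 c] by simp
    then show ?thesis using inter by simp
  qed
  then have "z \<ominus> t \<in> b\<^sub>2"
    using R.minus_closed[OF zR tR] by (intro ideal_colonI) auto
  then have "(z \<ominus> t) \<oplus> t \<in> B" using bB(2) t(1) B.a_closed by blast
  moreover have "(z \<ominus> t) \<oplus> t = z" using zR tR by (simp add: R.minus_eq R.a_assoc R.l_neg)
  ultimately show "z \<in> b\<^sub>1 <+>\<^bsub>R\<^esub> b\<^sub>2" unfolding B_def by simp
qed

text \<open>The annihilator of a nonzero ideal does not contain \<open>1\<close>, so it is a proper
  ideal.\<close>

lemma sum_proper:
  assumes "q\<^sub>1 \<noteq> {\<zero>}" "q\<^sub>2 \<noteq> {\<zero>}"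
  shows "b\<^sub>1 <+>\<^bsub>R\<^esub> b\<^sub>2 \<subseteq> \<mm>"
proof -
  have proper: "ideal_colon R {\<zero>} q \<subseteq> \<mm>" if q: "ideal q R" "q \<noteq> {\<zero>}" for q
  proof (rule proper_ideal_subset)
    interpret q: ideal q R by fact
    show "ideal (ideal_colon R {\<zero>} q) R"
      using R.zeroideal q.a_subset by (rule R.ideal_colon_ideal)
    obtain c where "c \<in> q" "c \<noteq> \<zero>" using q(2) q.zero_closed by blast
    then have "\<one> \<notin> ideal_colon R {\<zero>} q" using q.Icarr by (auto simp: ideal_colon_def)
    then show "ideal_colon R {\<zero>} q \<noteq> carrier R" by auto
  qed
  show ?thesis
    using proper[OF ideal1 assms(1)] proper[OF ideal2 assms(2)] maximal.a_closed
    by (auto simp: set_add_def')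
qed

lemma colon_q: "ideal_colon R q\<^sub>1 q\<^sub>2 = b\<^sub>2"
proof -
  have "r \<otimes> x = \<zero>" if r: "r \<in> carrier R" "\<forall>x\<in>q\<^sub>2. r \<otimes> x \<in> q\<^sub>1" and x: "x \<in> q\<^sub>2" for r x
  proof -
    have "r \<otimes> x \<in> q\<^sub>1 \<inter> q\<^sub>2" using r x ideal.I_l_closed[OF ideal2 x r(1)] by blast
    then show ?thesis using inter by simp
  qed
  moreover have "\<zero> \<in> q\<^sub>1" using inter by blast
  ultimately show ?thesis by (auto simp: ideal_colon_def)
qed

end

section \<open>The type\<close>

context noetherian_local_ring
begin

lemma socle_space_carrier: "carrier (socle_space R \<mm>) = ideal_colon R {\<zero>} \<mm>"
  by (simp add: socle_space_def)

lemma socle_space_ops: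
  "x \<oplus>\<^bsub>socle_space R \<mm>\<^esub> y = x \<oplus> y" "\<zero>\<^bsub>socle_space R \<mm>\<^esub> = \<zero>"
  by (simp_all add: socle_space_def)

text \<open>The representative picked by \<open>SOME\<close> differs from \<open>r\<close> by an
  element of \<open>\<mm>\<close>, which kills the socle.\<close>

lemma socle_space_smult:
  assumes "r \<in> carrier R" "x \<in> ideal_colon R {\<zero>} \<mm>"
  shows "(\<mm> +> r) \<odot>\<^bsub>socle_space R \<mm>\<^esub> x = r \<otimes> x"
proof -
  define s where "s = (SOME s. s \<in> \<mm> +> r)"
  have xR: "x \<in> carrier R" using assms(2) by (simp add: ideal_colon_def)
  have "s \<in> \<mm> +> r"
    unfolding s_def using maximal.a_rcos_self[OF assms(1)] by (rule someI)
  then obtain z where z: "z \<in> \<mm>" "s = z \<oplus> r" by (auto simp: a_r_coset_def')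
  have zR: "z \<in> carrier R" using z(1) by (rule maximal.Icarr)
  have "x \<otimes> z = \<zero>" using ideal_colonD(2)[OF assms(2) z(1)] by simp
  then have "z \<otimes> x = \<zero>" using m_comm[OF zR xR] by simp
  then have "s \<otimes> x = r \<otimes> x" using z(2) zR assms(1) xR by (simp add: l_distr)
  then show ?thesis by (simp add: socle_space_def s_def)
qed

lemma quotient_carrierE:
  assumes "X \<in> carrier (R Quot \<mm>)"
  obtains r where "r \<in> carrier R" "X = \<mm> +> r"
  using assms by (auto simp: FactRing_def A_RCOSETS_def')

lemma socle_vectorspace: "vectorspace (R Quot \<mm>) (socle_space R \<mm>)"
proof -
  interpret K: field "R Quot \<mm>" by (rule maximal.quotient_is_field[OF is_cring])
  interpret soc: ideal "ideal_colon R {\<zero>} \<mm>" R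
    using zeroideal maximal.a_subset by (rule ideal_colon_ideal)
  let ?V = "socle_space R \<mm>"
  have K_ops: "(\<mm> +> r) \<oplus>\<^bsub>R Quot \<mm>\<^esub> (\<mm> +> s) = \<mm> +> (r \<oplus> s)"
    "(\<mm> +> r) \<otimes>\<^bsub>R Quot \<mm>\<^esub> (\<mm> +> s) = \<mm> +> (r \<otimes> s)"
    if "r \<in> carrier R" "s \<in> carrier R" for r s
    using that by (simp_all add: FactRing_def maximal.a_rcos_sum maximal.rcoset_mult_add)
  have K_one: "\<one>\<^bsub>R Quot \<mm>\<^esub> = \<mm> +> \<one>" by (simp add: FactRing_def)
  have "module (R Quot \<mm>) ?V"
  proof (rule moduleI)
    show "cring (R Quot \<mm>)" by (rule K.is_cring)
    show "abelian_group ?V"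
    proof (rule abelian_groupI, unfold socle_space_carrier socle_space_ops)
      fix x y z
      assume x: "x \<in> ideal_colon R {\<zero>} \<mm>"
      show "\<zero> \<oplus> x = x" using soc.Icarr[OF x] by simp
      show "\<exists>y\<in>ideal_colon R {\<zero>} \<mm>. y \<oplus> x = \<zero>"
        using soc.a_inv_closed[OF x] l_neg[OF soc.Icarr[OF x]] by blast
      assume y: "y \<in> ideal_colon R {\<zero>} \<mm>"
      show "x \<oplus> y \<in> ideal_colon R {\<zero>} \<mm>" using x y by (rule soc.a_closed)
      show "x \<oplus> y = y \<oplus> x" using soc.Icarr[OF x] soc.Icarr[OF y] by (rule a_comm)
      assume z: "z \<in> ideal_colon R {\<zero>} \<mm>"
      show "x \<oplus> y \<oplus> z = x \<oplus> (y \<oplus> z)"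
        using soc.Icarr[OF x] soc.Icarr[OF y] soc.Icarr[OF z] by (rule a_assoc)
    qed (rule soc.zero_closed)
    fix X Y x y
    assume X: "X \<in> carrier (R Quot \<mm>)" and "x \<in> carrier ?V"
    then have x: "x \<in> ideal_colon R {\<zero>} \<mm>" by (simp only: socle_space_carrier)
    obtain r where r: "r \<in> carrier R" "X = \<mm> +> r" using X by (rule quotient_carrierE)
    show "X \<odot>\<^bsub>?V\<^esub> x \<in> carrier ?V"
      unfolding r(2) socle_space_smult[OF r(1) x] socle_space_carrier
      using x r(1) by (rule soc.I_l_closed)
    show "X \<odot>\<^bsub>?V\<^esub> (x \<oplus>\<^bsub>?V\<^esub> y) = X \<odot>\<^bsub>?V\<^esub> x \<oplus>\<^bsub>?V\<^esub> X \<odot>\<^bsub>?V\<^esub> y" if "y \<in> carrier ?V"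
    proof -
      have y: "y \<in> ideal_colon R {\<zero>} \<mm>" using that by (simp only: socle_space_carrier)
      show ?thesis
        unfolding r(2) socle_space_ops
        using socle_space_smult[OF r(1)] x y soc.a_closed[OF x y]
          r_distr[OF soc.Icarr[OF x] soc.Icarr[OF y] r(1)] by simp
    qed
    assume Y: "Y \<in> carrier (R Quot \<mm>)"
    obtain s where s: "s \<in> carrier R" "Y = \<mm> +> s" using Y by (rule quotient_carrierE)
    show "(X \<oplus>\<^bsub>R Quot \<mm>\<^esub> Y) \<odot>\<^bsub>?V\<^esub> x = X \<odot>\<^bsub>?V\<^esub> x \<oplus>\<^bsub>?V\<^esub> Y \<odot>\<^bsub>?V\<^esub> x"
      unfolding r(2) s(2) K_ops(1)[OF r(1) s(1)] socle_space_ops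
        socle_space_smult[OF r(1) x] socle_space_smult[OF s(1) x]
        socle_space_smult[OF a_closed[OF r(1) s(1)] x]
      using r(1) s(1) soc.Icarr[OF x] by (rule l_distr)
    show "(X \<otimes>\<^bsub>R Quot \<mm>\<^esub> Y) \<odot>\<^bsub>?V\<^esub> x = X \<odot>\<^bsub>?V\<^esub> (Y \<odot>\<^bsub>?V\<^esub> x)"
      unfolding r(2) s(2) K_ops(2)[OF r(1) s(1)] socle_space_smult[OF s(1) x]
        socle_space_smult[OF m_closed[OF r(1) s(1)] x]
        socle_space_smult[OF r(1) soc.I_l_closed[OF x s(1)]]
      using r(1) s(1) soc.Icarr[OF x] by (rule m_assoc)
  next
    fix x assume "x \<in> carrier ?V"
    then have x: "x \<in> ideal_colon R {\<zero>} \<mm>" by (simp only: socle_space_carrier)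
    show "\<one>\<^bsub>R Quot \<mm>\<^esub> \<odot>\<^bsub>?V\<^esub> x = x"
      unfolding K_one socle_space_smult[OF one_closed x] using soc.Icarr[OF x] by simp
  qed
  then show ?thesis by (intro vectorspace.intro K.field_axioms)
qed

end

text \<open>If zero is irreducible, a nonzero socle element \<open>u\<close> lies in every nonzero
  ideal, in particular in \<open>Rx\<close> for each nonzero \<open>x\<close> of the socle. In
  \<open>u = s x\<close> the coefficient is a unit, so \<open>u\<close> spans the socle. For type
  two this excludes a zero component in the decomposition.\<close>

lemma (in artinian_local_ring) type_le_1_if_zero_irreducible:
  assumes "irreducible_ideal R {\<zero>}"
  shows "local_ring_type R \<mm> \<le> 1"
proof -
  interpret V: vectorspace "R Quot \<mm>" "socle_space R \<mm>" by (rule socle_vectorspace)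
  have "{\<zero>} \<noteq> carrier R" using assms by (simp add: irreducible_ideal_def)
  with zeroideal obtain u where u: "u \<in> carrier R" "u \<notin> {\<zero>}" "\<And>z. z \<in> \<mm> \<Longrightarrow> z \<otimes> u \<in> {\<zero>}"
    by (rule exists_socle_element) blast
  have uS: "u \<in> ideal_colon R {\<zero>} \<mm>"
  proof (rule ideal_colonI[OF u(1)])
    fix z assume z: "z \<in> \<mm>"
    then show "u \<otimes> z \<in> {\<zero>}" using u(3)[OF z] m_comm[OF u(1) maximal.Icarr[OF z]] by simp
  qed
  then have uV: "{u} \<subseteq> carrier (socle_space R \<mm>)" by (simp add: socle_space_carrier)
  have "x \<in> V.span {u}" if "x \<in> carrier (socle_space R \<mm>)" for x
  proof -
    have xR: "x \<in> carrier R" using that by (simp add: socle_space_carrier ideal_colon_def)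
    have "\<exists>t\<in>carrier R. x = t \<otimes> u"
    proof (cases "x = \<zero>")
      case True
      then show ?thesis using u(1) by (intro bexI[of _ \<zero>]) auto
    next
      case False
      have "{\<zero>} \<subset> PIdl x"
        using cgenideal_self[OF xR] False additive_subgroup.zero_closed[OF ideal.axioms(1)[OF cgenideal_ideal[OF xR]]]
        by auto
      then have "u \<in> PIdl x"
        using irreducible_ideal_in_larger[OF assms u cgenideal_ideal[OF xR]] by blast
      then obtain s where s: "s \<in> carrier R" "u = s \<otimes> x" by (auto simp: cgenideal_def)
      have "x \<otimes> z = \<zero>" if "z \<in> \<mm>" for z
        using \<open>x \<in> carrier (socle_space R \<mm>)\<close> that
        by (simp add: socle_space_carrier ideal_colon_def)
      then have "s \<notin> \<mm>" using s u(2) xR m_comm[OF s(1) xR] by auto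
      with s(1) obtain t where t: "t \<in> carrier R" "t \<otimes> s = \<one>" by (rule unit_if_notin)
      have "t \<otimes> u = (t \<otimes> s) \<otimes> x" unfolding s(2) using t(1) s(1) xR by (simp add: m_assoc)
      then show ?thesis using t xR by (intro bexI[of _ t]) simp_all
    qed
    then obtain t where t: "t \<in> carrier R" "x = t \<otimes> u" by blast
    have tK: "\<mm> +> t \<in> carrier (R Quot \<mm>)"
      using t(1) by (auto simp: FactRing_def A_RCOSETS_def')
    have "V.lincomb (\<lambda>_. \<mm> +> t) {u} = (\<mm> +> t) \<odot>\<^bsub>socle_space R \<mm>\<^esub> u"
      unfolding V.lincomb_def using tK uV by (subst V.M.finsum_insert) auto
    also have "\<dots> = x" unfolding t(2) using t(1) uS by (rule socle_space_smult)
    finally have "x = V.lincomb (\<lambda>_. \<mm> +> t) {u}" by simp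
    then show ?thesis unfolding V.span_def using tK by blast
  qed
  then have "V.span {u} = carrier (socle_space R \<mm>)"
    using V.span_is_subset2[OF uV] by blast
  \<comment> \<open>The dimension is a least cardinality of spanning sets, so a spanning singleton
    bounds it.\<close>
  then have "V.dim \<le> 1"
    unfolding V.dim_def using uV by (intro Least_le exI[of _ "{u}"]) simp
  then show ?thesis by (simp add: local_ring_type_def)
qed

section \<open>Transfer along a surjective ring homomorphism\<close>

locale surjective_ring_hom = ring_hom_cring R S h
  for R :: "('a, 'c) ring_scheme" (structure) and S :: "('b, 'd) ring_scheme" (structure) and h +
  assumes surj: "h ` carrier R = carrier S"
begin

lemma preimage:
  assumes "y \<in> carrier S"
  obtains x where "x \<in> carrier R" "y = h x"
proof -
  have "y \<in> h ` carrier R" unfolding surj by (rule assms)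
  then show thesis using that by (elim imageE)
qed

text \<open>Elements with equal images differ by an element of the kernel, hence of
  \<open>J\<close>. This is the basis of the correspondence between ideals of the target and ideals
  containing the kernel.\<close>

lemma image_mem_iff:
  assumes J: "ideal J R" "a_kernel R S h \<subseteq> J" and x: "x \<in> carrier R"
  shows "h x \<in> h ` J \<longleftrightarrow> x \<in> J"
proof
  interpret J: ideal J R by fact
  assume "h x \<in> h ` J"
  then obtain y where y: "y \<in> J" "h x = h y" by blast
  have yR: "y \<in> carrier R" using y(1) by (rule J.Icarr)
  have "h (x \<ominus>\<^bsub>R\<^esub> y) = \<zero>\<^bsub>S\<^esub>"
    using x yR y(2) by (simp add: R.minus_eq S.r_neg)
  then have "x \<ominus>\<^bsub>R\<^esub> y \<in> a_kernel R S h"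
    unfolding a_kernel_def' using R.minus_closed[OF x yR] by (intro CollectI conjI)
  then have "x \<ominus>\<^bsub>R\<^esub> y \<in> J" using J(2) by (rule subsetD[rotated])
  then have "(x \<ominus>\<^bsub>R\<^esub> y) \<oplus>\<^bsub>R\<^esub> y \<in> J" using y(1) by (rule J.a_closed)
  moreover have "(x \<ominus>\<^bsub>R\<^esub> y) \<oplus>\<^bsub>R\<^esub> y = x" using x yR by (simp add: R.minus_eq R.a_assoc R.l_neg)
  ultimately show "x \<in> J" by simp
qed (rule imageI)

lemma image_ideal:
  assumes "ideal J R"
  shows "ideal (h ` J) S"
proof -
  interpret J: ideal J R by fact
  show ?thesis
  proof (rule S.ideal_of_closed)
    show "h ` J \<subseteq> carrier S" using J.Icarr by auto
    show "\<zero>\<^bsub>S\<^esub> \<in> h ` J" using J.zero_closed hom_zero by (metis image_eqI)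
    fix a b assume "a \<in> h ` J" "b \<in> h ` J"
    then obtain x y where "x \<in> J" "y \<in> J" "a = h x" "b = h y" by blast
    then show "a \<oplus>\<^bsub>S\<^esub> b \<in> h ` J"
      using hom_add[OF J.Icarr J.Icarr, of x y] J.a_closed[of x y] by (metis image_eqI)
  next
    fix r a assume "r \<in> carrier S" "a \<in> h ` J"
    then obtain s x where "s \<in> carrier R" "x \<in> J" "r = h s" "a = h x" using surj by blast
    then show "r \<otimes>\<^bsub>S\<^esub> a \<in> h ` J"
      using hom_mult[OF _ J.Icarr, of s x] J.I_l_closed[of x s] by (metis image_eqI)
  qed
qed

lemma image_vimage:
  assumes "A \<subseteq> carrier S"
  shows "h ` {x \<in> carrier R. h x \<in> A} = A"
proof (intro subset_antisym subsetI)
  fix y assume y: "y \<in> A"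
  with assms have "y \<in> carrier S" by (rule subsetD)
  then obtain x where "x \<in> carrier R" "y = h x" by (rule preimage)
  with y show "y \<in> h ` {x \<in> carrier R. h x \<in> A}" by blast
next
  fix y assume "y \<in> h ` {x \<in> carrier R. h x \<in> A}"
  then obtain x where "y = h x" "x \<in> {x \<in> carrier R. h x \<in> A}" by (rule imageE)
  then show "y \<in> A" by simp
qed

lemma kernel_subset_vimage:
  assumes "ideal A S"
  shows "a_kernel R S h \<subseteq> {x \<in> carrier R. h x \<in> A}"
proof (rule subsetI)
  fix x assume "x \<in> a_kernel R S h"
  then have "x \<in> carrier R" "h x = \<zero>\<^bsub>S\<^esub>" unfolding a_kernel_def' by blast+
  moreover have "\<zero>\<^bsub>S\<^esub> \<in> A" using assms by (intro additive_subgroup.zero_closed ideal.axioms(1))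
  ultimately show "x \<in> {x \<in> carrier R. h x \<in> A}" by simp
qed

text \<open>A splitting of the image pulls back to a splitting of \<open>J\<close>: preimages of
  strictly larger ideals are strictly larger, and they meet exactly in \<open>J\<close> because
  \<open>J\<close> contains the kernel.\<close>

lemma image_irreducible:
  assumes J: "irreducible_ideal R J" "a_kernel R S h \<subseteq> J"
  shows "irreducible_ideal S (h ` J)"
proof -
  have JI: "ideal J R" and Jc: "J \<noteq> carrier R"
    and irr: "\<And>A B. ideal A R \<Longrightarrow> ideal B R \<Longrightarrow> J \<subset> A \<Longrightarrow> J \<subset> B \<Longrightarrow> J \<noteq> A \<inter> B"
    using J(1) by (auto simp: irreducible_ideal_def)
  note mem = image_mem_iff[OF JI J(2)]
  have JR: "J \<subseteq> carrier R" using ideal.Icarr[OF JI] by blast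
  have proper: "h ` J \<noteq> carrier S"
  proof
    assume "h ` J = carrier S"
    then have "x \<in> J" if "x \<in> carrier R" for x using mem[OF that] that by simp
    with JR Jc show False by blast
  qed
  have no_split: False
    if AB: "ideal A S" "ideal B S" "h ` J \<subset> A" "h ` J \<subset> B" "h ` J = A \<inter> B" for A B
  proof -
    define vim where "vim A = {x \<in> carrier R. h x \<in> A}" for A
    have larger: "J \<subset> vim A" if A: "ideal A S" "h ` J \<subset> A" for A
    proof -
      have sub: "J \<subseteq> vim A" using JR A(2) by (auto simp: vim_def)
      obtain y where y: "y \<in> A" "y \<notin> h ` J" using A(2) by blast
      have "y \<in> carrier S" using A(1) y(1) by (rule ideal.Icarr)
      then obtain x where "x \<in> carrier R" "y = h x" by (rule preimage)
      then have "x \<in> vim A" "x \<notin> J" using y by (auto simp: vim_def)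
      with sub show ?thesis by blast
    qed
    have "J \<noteq> vim A \<inter> vim B"
    proof (rule irr)
      show "ideal (vim A) R" unfolding vim_def using AB(1) by (rule ring.ideal_vimage)
      show "ideal (vim B) R" unfolding vim_def using AB(2) by (rule ring.ideal_vimage)
      show "J \<subset> vim A" using AB(1,3) by (rule larger)
      show "J \<subset> vim B" using AB(2,4) by (rule larger)
    qed
    moreover have "J = vim A \<inter> vim B"
    proof
      show "J \<subseteq> vim A \<inter> vim B" using larger AB by blast
      show "vim A \<inter> vim B \<subseteq> J"
      proof
        fix x assume "x \<in> vim A \<inter> vim B"
        then have "x \<in> carrier R" "h x \<in> h ` J" unfolding AB(5) by (auto simp: vim_def)
        then show "x \<in> J" using mem by simp
      qed
    qed
    ultimately show False by contradiction
  qed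
  show ?thesis
    unfolding irreducible_ideal_def
  proof (intro conjI)
    show "ideal (h ` J) S" using JI by (rule image_ideal)
    show "h ` J \<noteq> carrier S" by (rule proper)
    show "\<nexists>A B. ideal A S \<and> ideal B S \<and> h ` J \<subset> A \<and> h ` J \<subset> B \<and> h ` J = A \<inter> B"
      by (intro notI, elim exE conjE) (rule no_split)
  qed
qed

lemma image_colon:
  assumes J: "ideal J R" "a_kernel R S h \<subseteq> J" and K: "K \<subseteq> carrier R"
  shows "h ` ideal_colon R J K = ideal_colon S (h ` J) (h ` K)"
proof -
  have iff: "h x \<in> ideal_colon S (h ` J) (h ` K) \<longleftrightarrow> x \<in> ideal_colon R J K"
    if x: "x \<in> carrier R" for x
  proof -
    have "h x \<otimes>\<^bsub>S\<^esub> h k \<in> h ` J \<longleftrightarrow> x \<otimes>\<^bsub>R\<^esub> k \<in> J" if "k \<in> K" for k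
    proof -
      have "k \<in> carrier R" using K that by blast
      then show ?thesis using image_mem_iff[OF J, of "x \<otimes>\<^bsub>R\<^esub> k"] x by simp
    qed
    then show ?thesis using x by (auto simp: ideal_colon_def)
  qed
  show ?thesis
  proof
    show "h ` ideal_colon R J K \<subseteq> ideal_colon S (h ` J) (h ` K)"
    proof (rule image_subsetI)
      fix x assume x: "x \<in> ideal_colon R J K"
      then have "x \<in> carrier R" by (rule ideal_colonD)
      with x show "h x \<in> ideal_colon S (h ` J) (h ` K)" by (simp only: iff)
    qed
    show "ideal_colon S (h ` J) (h ` K) \<subseteq> h ` ideal_colon R J K"
    proof
      fix y assume y: "y \<in> ideal_colon S (h ` J) (h ` K)"
      then have "y \<in> carrier S" by (rule ideal_colonD)
      then obtain x where x: "x \<in> carrier R" "y = h x" by (rule preimage)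
      then show "y \<in> h ` ideal_colon R J K" using y iff by blast
    qed
  qed
qed

lemma image_set_add:
  assumes "A \<subseteq> carrier R" "B \<subseteq> carrier R"
  shows "h ` (A <+>\<^bsub>R\<^esub> B) = h ` A <+>\<^bsub>S\<^esub> h ` B"
proof -
  have hom: "h (a \<oplus>\<^bsub>R\<^esub> b) = h a \<oplus>\<^bsub>S\<^esub> h b" if "a \<in> A" "b \<in> B" for a b
    using assms that by (intro hom_add) auto
  show ?thesis
  proof (intro subset_antisym subsetI)
    fix y assume "y \<in> h ` (A <+>\<^bsub>R\<^esub> B)"
    then obtain a b where ab: "a \<in> A" "b \<in> B" "y = h (a \<oplus>\<^bsub>R\<^esub> b)"
      unfolding set_add_def' by blast
    show "y \<in> h ` A <+>\<^bsub>S\<^esub> h ` B"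
      unfolding set_add_def' ab(3) hom[OF ab(1,2)] using ab(1,2) by blast
  next
    fix y assume "y \<in> h ` A <+>\<^bsub>S\<^esub> h ` B"
    then obtain a b where ab: "a \<in> A" "b \<in> B" "y = h a \<oplus>\<^bsub>S\<^esub> h b"
      unfolding set_add_def' by blast
    show "y \<in> h ` (A <+>\<^bsub>R\<^esub> B)"
      unfolding set_add_def' ab(3) hom[OF ab(1,2), symmetric] using ab(1,2) by blast
  qed
qed

lemma image_eq_iff:
  assumes "ideal A R" "a_kernel R S h \<subseteq> A" "ideal B R" "a_kernel R S h \<subseteq> B"
  shows "h ` A = h ` B \<longleftrightarrow> A = B"
proof
  assume eq: "h ` A = h ` B"
  have "x \<in> A \<longleftrightarrow> x \<in> B" if "x \<in> carrier R" for x
    using image_mem_iff[OF assms(1,2) that] image_mem_iff[OF assms(3,4) that] eq by simp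
  then show "A = B" using ideal.Icarr[OF assms(1)] ideal.Icarr[OF assms(3)] by blast
qed (erule ssubst, rule refl)

text \<open>An ideal above the preimage contains the kernel, so it is determined by its image, which
  is \<open>A\<close> or everything.\<close>

lemma maximal_vimage:
  assumes "maximalideal A S"
  shows "maximalideal {x \<in> carrier R. h x \<in> A} R"
proof (rule maximalidealI)
  have A: "ideal A S" using assms by (rule maximalideal.axioms(1))
  have A_sub: "A \<subseteq> carrier S" using ideal.Icarr[OF A] by (rule subsetI)
  show "ideal {x \<in> carrier R. h x \<in> A} R" using A by (rule ring.ideal_vimage)
  have "\<one>\<^bsub>S\<^esub> \<notin> A"
  proof
    assume "\<one>\<^bsub>S\<^esub> \<in> A"
    then have "A = carrier S" by (rule ideal.one_imp_carrier[OF A])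
    then show False using maximalideal.I_notcarr[OF assms] by simp
  qed
  then have "\<one>\<^bsub>R\<^esub> \<notin> {x \<in> carrier R. h x \<in> A}" by simp
  then show "carrier R \<noteq> {x \<in> carrier R. h x \<in> A}" using R.one_closed by blast
  fix J assume J: "ideal J R" "{x \<in> carrier R. h x \<in> A} \<subseteq> J" "J \<subseteq> carrier R"
  have ker: "a_kernel R S h \<subseteq> J" using kernel_subset_vimage[OF A] J(2) by (rule subset_trans)
  have "h ` {x \<in> carrier R. h x \<in> A} \<subseteq> h ` J" using J(2) by (rule image_mono)
  then have "A \<subseteq> h ` J" unfolding image_vimage[OF A_sub] .
  moreover have "h ` J \<subseteq> carrier S" using image_mono[OF J(3), of h] unfolding surj .
  ultimately have "h ` J = A \<or> h ` J = carrier S"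
    by (rule maximalideal.I_maximal[OF assms image_ideal[OF J(1)]])
  then show "J = {x \<in> carrier R. h x \<in> A} \<or> J = carrier R"
  proof
    assume eq: "h ` J = A"
    have "J \<subseteq> {x \<in> carrier R. h x \<in> A}"
    proof (rule subsetI)
      fix x assume x: "x \<in> J"
      have "h x \<in> A" using imageI[OF x, of h] unfolding eq .
      with subsetD[OF J(3) x] show "x \<in> {x \<in> carrier R. h x \<in> A}" by simp
    qed
    with J(2) show ?thesis by blast
  next
    assume eq: "h ` J = carrier S"
    have "carrier R \<subseteq> J"
    proof (rule subsetI)
      fix x assume x: "x \<in> carrier R"
      then have "h x \<in> h ` J" unfolding eq by (rule hom_closed)
      then show "x \<in> J" using image_mem_iff[OF J(1) ker x] by simp
    qed
    with J(3) show ?thesis by blast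
  qed
qed

end

text \<open>The surjection is the projection to the quotient followed by the isomorphism;
  injectivity of the latter keeps the kernel equal to \<open>I\<close>.\<close>

lemma quotient_iso_surjection:
  assumes "cring S" "cring R" "ideal I S" "(S Quot I) \<simeq> R"
  obtains h where "surjective_ring_hom S R h" "a_kernel S R h = I"
proof -
  interpret I: ideal I S by fact
  obtain \<phi> where "\<phi> \<in> ring_iso (S Quot I) R"
    using assms(4) by (auto simp: is_ring_iso_def)
  then have hom: "\<phi> \<in> ring_hom (S Quot I) R"
    and bij: "bij_betw \<phi> (carrier (S Quot I)) (carrier R)"
    by (simp_all add: ring_iso_def)
  define h where "h = \<phi> \<circ> (+>\<^bsub>S\<^esub>) I"
  have Quot_carrier: "carrier (S Quot I) = (+>\<^bsub>S\<^esub>) I ` carrier S"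
    by (auto simp: FactRing_def A_RCOSETS_def')
  have "h \<in> ring_hom S R"
    unfolding h_def using I.rcos_ring_hom hom by (rule ring_hom_trans)
  moreover have "h ` carrier S = carrier R"
    unfolding h_def image_comp[symmetric] Quot_carrier[symmetric]
    using bij by (rule bij_betw_imp_surj_on)
  ultimately have surjective: "surjective_ring_hom S R h"
    using assms(1,2)
    by (intro surjective_ring_hom.intro surjective_ring_hom_axioms.intro
        ring_hom_cring.intro ring_hom_cring_axioms.intro)
  then have cring_hom: "ring_hom_cring S R h" by (rule surjective_ring_hom.axioms)
  have zero: "h \<zero>\<^bsub>S\<^esub> = \<zero>\<^bsub>R\<^esub>" using cring_hom by (rule ring_hom_cring.hom_zero)
  have coset_zero: "I +>\<^bsub>S\<^esub> \<zero>\<^bsub>S\<^esub> = I" using I.a_subset by (rule I.a_coset_add_zero)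
  have "h x = \<zero>\<^bsub>R\<^esub> \<longleftrightarrow> x \<in> I" if x: "x \<in> carrier S" for x
  proof
    assume "h x = \<zero>\<^bsub>R\<^esub>"
    then have "\<phi> (I +>\<^bsub>S\<^esub> x) = \<phi> (I +>\<^bsub>S\<^esub> \<zero>\<^bsub>S\<^esub>)"
      using zero unfolding h_def o_def by simp
    moreover have "I +>\<^bsub>S\<^esub> x \<in> carrier (S Quot I)" "I +>\<^bsub>S\<^esub> \<zero>\<^bsub>S\<^esub> \<in> carrier (S Quot I)"
      unfolding Quot_carrier using x I.zero_closed I.Icarr by (blast intro: imageI)+
    ultimately have "I +>\<^bsub>S\<^esub> x = I +>\<^bsub>S\<^esub> \<zero>\<^bsub>S\<^esub>"
      by (rule inj_onD[OF bij_betw_imp_inj_on[OF bij]])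
    then show "x \<in> I" using I.a_rcos_self[OF x] unfolding coset_zero by simp
  next
    assume "x \<in> I"
    then have "I +>\<^bsub>S\<^esub> x = I +>\<^bsub>S\<^esub> \<zero>\<^bsub>S\<^esub>"
      unfolding coset_zero by (rule I.a_rcos_zero[OF I.is_ideal])
    then show "h x = \<zero>\<^bsub>R\<^esub>" using zero unfolding h_def o_def by simp
  qed
  then have "a_kernel S R h = I"
    unfolding a_kernel_def' using I.Icarr by blast
  with surjective that show thesis by blast
qed

section \<open>The four equivalent conditions for \<open>R = S/I\<close>\<close>

theorem theorem4p2:
  fixes R :: "'a ring" and \<mm> :: "'a set" and \<omega> :: "('a, 'w) module"
    and S :: "'s ring" and \<mm>\<^sub>S I J\<^sub>1 J\<^sub>2 :: "'s set"
    and P :: "'a set set"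
  assumes "noetherian_local_ring R \<mm>"
    and "artinian_ring R"
    and "local_ring_type R \<mm> = 2"
    and "canonical_module R \<mm> \<omega>"
    and "regular_local_ring S \<mm>\<^sub>S"
    and "ideal I S"
    and "(S Quot I) \<simeq> R"
    and "irreducible_ideal S J\<^sub>1"
    and "irreducible_ideal S J\<^sub>2"
    and "I = J\<^sub>1 \<inter> J\<^sub>2"
    and "\<And>p. p \<in> P \<Longrightarrow> primeideal p R \<and> p \<noteq> \<mm>"
    and "finite P \<or> countable P \<and> (adically_complete R \<mm> \<or> uncountable (carrier (R Quot \<mm>)))"
  shows
    "(\<mm> \<subseteq> trace_ideal R \<omega>
      \<longleftrightarrow>
      (\<forall>K \<aa>. (\<exists>xs. system_of_parameters R \<mm> xs \<and> K = Idl\<^bsub>R\<^esub> (set xs)) \<and> ideal \<aa> R \<and> K \<subseteq> \<aa>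
         \<longrightarrow> ideal_colon R K (ideal_colon R K \<aa>) \<subseteq> ideal_colon R \<aa> \<mm>))
     \<and>
     (\<mm> \<subseteq> trace_ideal R \<omega>
      \<longleftrightarrow>
      (\<forall>K \<aa>. (\<exists>xs. system_of_parameters R \<mm> xs \<and> (\<forall>x\<in>set xs. \<forall>p\<in>P. x \<notin> p) \<and> K = Idl\<^bsub>R\<^esub> (set xs))
           \<and> ideal \<aa> R \<and> K \<subseteq> \<aa>
         \<longrightarrow> ideal_colon R K (ideal_colon R K \<aa>) \<subseteq> ideal_colon R \<aa> \<mm>))
     \<and>
     (\<mm> \<subseteq> trace_ideal R \<omega>
      \<longleftrightarrow>
      ideal_colon S J\<^sub>1 J\<^sub>2 <+>\<^bsub>S\<^esub> ideal_colon S J\<^sub>2 J\<^sub>1 = \<mm>\<^sub>S)"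
proof -
  interpret R: artinian_local_ring R \<mm>
    using assms(1,2) by (intro artinian_local_ring.intro artinian_local_ring_axioms.intro)
  interpret canon: artinian_canonical R \<mm> \<omega>
  proof (intro artinian_canonical.intro artinian_canonical_axioms.intro R.artinian_local_ring_axioms assms(4))
    show "module R \<omega>"
      using assms(4) by (simp add: canonical_module_def injective_hull_def injective_module_def)
  qed
  have "noetherian_local_ring S \<mm>\<^sub>S" using assms(5) by (simp add: regular_local_ring_def)
  then interpret S: noetherian_local_ring S \<mm>\<^sub>S .
  interpret I: ideal I S by fact
  obtain h where surjective: "surjective_ring_hom S R h" and kernel: "a_kernel S R h = I"
    by (rule quotient_iso_surjection[OF S.is_cring R.is_cring assms(6,7)])
  interpret h: surjective_ring_hom S R h by (rule surjective)
  have J: "ideal J\<^sub>1 S" "ideal J\<^sub>2 S" and IJ: "I \<subseteq> J\<^sub>1" "I \<subseteq> J\<^sub>2"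
    using assms(8,9) unfolding irreducible_ideal_def assms(10) by blast+
  have JS: "J\<^sub>1 \<subseteq> carrier S" "J\<^sub>2 \<subseteq> carrier S"
    using ideal.Icarr[OF J(1)] ideal.Icarr[OF J(2)] by blast+
  have ker: "a_kernel S R h \<subseteq> J\<^sub>1" "a_kernel S R h \<subseteq> J\<^sub>2" unfolding kernel by (fact IJ)+
  define q\<^sub>1 where "q\<^sub>1 = h ` J\<^sub>1"
  define q\<^sub>2 where "q\<^sub>2 = h ` J\<^sub>2"
  have irr: "irreducible_ideal R q\<^sub>1" "irreducible_ideal R q\<^sub>2"
    unfolding q\<^sub>1_def q\<^sub>2_def
    by (rule h.image_irreducible[OF assms(8) ker(1)], rule h.image_irreducible[OF assms(9) ker(2)])
  have q: "ideal q\<^sub>1 R" "ideal q\<^sub>2 R" using irr by (simp_all add: irreducible_ideal_def)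
  have inter: "q\<^sub>1 \<inter> q\<^sub>2 = {\<zero>\<^bsub>R\<^esub>}"
  proof (intro subset_antisym subsetI)
    fix y assume "y \<in> q\<^sub>1 \<inter> q\<^sub>2"
    then have y: "y \<in> h ` J\<^sub>1" "y \<in> h ` J\<^sub>2" unfolding q\<^sub>1_def q\<^sub>2_def by (rule IntD1, rule IntD2)
    from y(1) obtain x where x: "x \<in> J\<^sub>1" "y = h x" by (rule imageE)
    have "x \<in> J\<^sub>2"
      using h.image_mem_iff[OF J(2) ker(2) subsetD[OF JS(1) x(1)]] y(2) unfolding x(2) by (rule iffD1)
    with x(1) have "x \<in> a_kernel S R h" unfolding kernel assms(10) by (rule IntI)
    then show "y \<in> {\<zero>\<^bsub>R\<^esub>}" unfolding a_kernel_def' x(2) by blast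
  next
    fix y assume "y \<in> {\<zero>\<^bsub>R\<^esub>}"
    then show "y \<in> q\<^sub>1 \<inter> q\<^sub>2"
      using q by (simp add: additive_subgroup.zero_closed ideal.axioms(1))
  qed
  \<comment> \<open>Type two enters here: if one of the images were zero, the zero ideal would be
    irreducible and the type at most one.\<close>
  have "\<not> irreducible_ideal R {\<zero>\<^bsub>R\<^esub>}"
    using R.type_le_1_if_zero_irreducible assms(3) by auto
  then have nonzero: "q\<^sub>1 \<noteq> {\<zero>\<^bsub>R\<^esub>}" "q\<^sub>2 \<noteq> {\<zero>\<^bsub>R\<^esub>}" using irr by auto
  obtain w\<^sub>1 where w1: "w\<^sub>1 \<in> carrier \<omega>"
    "\<And>c. c \<in> carrier R \<Longrightarrow> c \<odot>\<^bsub>\<omega>\<^esub> w\<^sub>1 = \<zero>\<^bsub>\<omega>\<^esub> \<longleftrightarrow> c \<in> q\<^sub>1"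
    using irr(1) by (rule canon.irreducible_annihilator) blast
  obtain w\<^sub>2 where w2: "w\<^sub>2 \<in> carrier \<omega>"
    "\<And>c. c \<in> carrier R \<Longrightarrow> c \<odot>\<^bsub>\<omega>\<^esub> w\<^sub>2 = \<zero>\<^bsub>\<omega>\<^esub> \<longleftrightarrow> c \<in> q\<^sub>2"
    using irr(2) by (rule canon.irreducible_annihilator) blast
  interpret pair: irreducible_pair R \<mm> \<omega> q\<^sub>1 q\<^sub>2 w\<^sub>1 w\<^sub>2
    by (intro irreducible_pair.intro irreducible_pair_axioms.intro
        canon.artinian_canonical_axioms q inter w1 w2)
  let ?b1 = "ideal_colon R {\<zero>\<^bsub>R\<^esub>} q\<^sub>1" and ?b2 = "ideal_colon R {\<zero>\<^bsub>R\<^esub>} q\<^sub>2"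

  define colon_condition where "colon_condition \<longleftrightarrow> (\<forall>\<aa>. ideal \<aa> R \<longrightarrow>
    ideal_colon R {\<zero>\<^bsub>R\<^esub>} (ideal_colon R {\<zero>\<^bsub>R\<^esub>} \<aa>) \<subseteq> ideal_colon R \<aa> \<mm>)"
  have zero_subset: "{\<zero>\<^bsub>R\<^esub>} \<subseteq> \<aa>" if "ideal \<aa> R" for \<aa>
    using that by (simp add: additive_subgroup.zero_closed ideal.axioms(1))
  have trace_iff_colon: "\<mm> \<subseteq> trace_ideal R \<omega> \<longleftrightarrow> colon_condition"
  proof
    assume "\<mm> \<subseteq> trace_ideal R \<omega>"
    then show colon_condition
      unfolding colon_condition_def using canon.trace_implies_colon by blast
  next
    \<comment> \<open>The instance \<open>\<aa> = q\<^sub>1\<close> suffices for this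
      direction.\<close>
    assume colon_condition
    then have "ideal_colon R {\<zero>\<^bsub>R\<^esub>} ?b1 \<subseteq> ideal_colon R q\<^sub>1 \<mm>"
      unfolding colon_condition_def using q(1) by blast
    then show "\<mm> \<subseteq> trace_ideal R \<omega>"
      unfolding pair.trace_eq by (rule pair.colon_implies_sum)
  qed

  \<comment> \<open>The preimage of \<open>\<mm>\<close> is a maximal ideal, and \<open>S\<close>
    has only one.\<close>
  have maximal_S: "\<mm>\<^sub>S = {x \<in> carrier S. h x \<in> \<mm>}"
    using S.unique_maximal[OF h.maximal_vimage[OF R.maximal]] by simp
  have kernel_maximal: "a_kernel S R h \<subseteq> \<mm>\<^sub>S"
    unfolding maximal_S by (rule h.kernel_subset_vimage[OF R.maximal.is_ideal])
  have image_maximal: "h ` \<mm>\<^sub>S = \<mm>"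
    unfolding maximal_S by (rule h.image_vimage[OF R.maximal.a_subset])
  let ?C12 = "ideal_colon S J\<^sub>1 J\<^sub>2" and ?C21 = "ideal_colon S J\<^sub>2 J\<^sub>1"
  have C: "ideal ?C12 S" "ideal ?C21 S"
    by (rule S.ideal_colon_ideal[OF J(1) JS(2)], rule S.ideal_colon_ideal[OF J(2) JS(1)])
  have CS: "?C12 \<subseteq> carrier S" "?C21 \<subseteq> carrier S" unfolding ideal_colon_def by blast+
  \<comment> \<open>The sum of colons contains the kernel, as does \<open>\<mm>\<^sub>S\<close>, so
    their equality can be tested on images in \<open>R\<close>.\<close>
  have "I \<subseteq> ?C12" using I.is_ideal IJ(1) JS(2) by (rule S.ideal_subset_colon)
  also have "\<dots> \<subseteq> ?C12 <+>\<^bsub>S\<^esub> ?C21" using C by (rule S.ideal_subset_sum)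
  finally have kernel_sum: "a_kernel S R h \<subseteq> ?C12 <+>\<^bsub>S\<^esub> ?C21" unfolding kernel .
  have "h ` ?C12 = ideal_colon R q\<^sub>1 q\<^sub>2"
    unfolding q\<^sub>1_def q\<^sub>2_def by (rule h.image_colon[OF J(1) ker(1) JS(2)])
  also have "\<dots> = ?b2" by (rule pair.colon_q)
  finally have image12: "h ` ?C12 = ?b2" .
  have "h ` ?C21 = ideal_colon R q\<^sub>2 q\<^sub>1"
    unfolding q\<^sub>1_def q\<^sub>2_def by (rule h.image_colon[OF J(2) ker(2) JS(1)])
  also have "\<dots> = ?b1" by (rule irreducible_pair.colon_q[OF pair.swap])
  finally have image21: "h ` ?C21 = ?b1" .
  have bR: "?b1 \<subseteq> carrier R" "?b2 \<subseteq> carrier R" unfolding ideal_colon_def by blast+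
  have "h ` (?C12 <+>\<^bsub>S\<^esub> ?C21) = ?b2 <+>\<^bsub>R\<^esub> ?b1"
    unfolding h.image_set_add[OF CS] image12 image21 ..
  also have "\<dots> = ?b1 <+>\<^bsub>R\<^esub> ?b2" using bR(2,1) by (rule R.set_add_comm)
  also have "\<dots> = trace_ideal R \<omega>" by (rule pair.trace_eq[symmetric])
  finally have image_sum: "h ` (?C12 <+>\<^bsub>S\<^esub> ?C21) = trace_ideal R \<omega>" .
  \<comment> \<open>Since the components are nonzero, the trace lies in \<open>\<mm>\<close>, and
    equality with \<open>\<mm>\<close> reduces to one inclusion.\<close>
  have trace_subset: "trace_ideal R \<omega> \<subseteq> \<mm>"
    unfolding pair.trace_eq by (rule pair.sum_proper[OF nonzero])
  have "?C12 <+>\<^bsub>S\<^esub> ?C21 = \<mm>\<^sub>S \<longleftrightarrow> h ` (?C12 <+>\<^bsub>S\<^esub> ?C21) = h ` \<mm>\<^sub>S"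
    by (rule h.image_eq_iff[symmetric, OF S.add_ideals[OF C] kernel_sum S.maximal.is_ideal kernel_maximal])
  also have "\<dots> \<longleftrightarrow> trace_ideal R \<omega> = \<mm>" unfolding image_sum image_maximal ..
  also have "\<dots> \<longleftrightarrow> \<mm> \<subseteq> trace_ideal R \<omega>"
    by (rule iffI, rule equalityD2, assumption, rule subset_antisym[OF trace_subset])
  finally
  have trace_iff_sum: "?C12 <+>\<^bsub>S\<^esub> ?C21 = \<mm>\<^sub>S \<longleftrightarrow> \<mm> \<subseteq> trace_ideal R \<omega>" .

  \<comment> \<open>Only the empty list is a system of parameters. It generates the zero ideal and
    satisfies the avoidance clause for \<open>P\<close> vacuously, so both parameter conditions
    become the same.\<close>
  have no_parameters: "(\<exists>xs. system_of_parameters R \<mm> xs \<and> K = Idl\<^bsub>R\<^esub> (set xs)) \<longleftrightarrow> K = {\<zero>\<^bsub>R\<^esub>}"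
    "(\<exists>xs. system_of_parameters R \<mm> xs \<and> (\<forall>x\<in>set xs. \<forall>p\<in>P. x \<notin> p) \<and> K = Idl\<^bsub>R\<^esub> (set xs))
      \<longleftrightarrow> K = {\<zero>\<^bsub>R\<^esub>}" for K
    unfolding R.system_of_parameters_iff by (simp_all add: R.Idl_empty)
  have colon_iff: "(\<forall>K \<aa>. K = {\<zero>\<^bsub>R\<^esub>} \<and> ideal \<aa> R \<and> K \<subseteq> \<aa> \<longrightarrow>
      ideal_colon R K (ideal_colon R K \<aa>) \<subseteq> ideal_colon R \<aa> \<mm>) \<longleftrightarrow> colon_condition"
  proof (intro iffI allI impI)
    assume *: "\<forall>K \<aa>. K = {\<zero>\<^bsub>R\<^esub>} \<and> ideal \<aa> R \<and> K \<subseteq> \<aa> \<longrightarrow>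
      ideal_colon R K (ideal_colon R K \<aa>) \<subseteq> ideal_colon R \<aa> \<mm>"
    show colon_condition
      unfolding colon_condition_def
    proof (intro allI impI)
      fix \<aa> assume "ideal \<aa> R"
      then show "ideal_colon R {\<zero>\<^bsub>R\<^esub>} (ideal_colon R {\<zero>\<^bsub>R\<^esub>} \<aa>) \<subseteq> ideal_colon R \<aa> \<mm>"
        by (intro *[rule_format] conjI refl zero_subset)
    qed
  next
    fix K \<aa> assume colon_condition and K: "K = {\<zero>\<^bsub>R\<^esub>} \<and> ideal \<aa> R \<and> K \<subseteq> \<aa>"
    then show "ideal_colon R K (ideal_colon R K \<aa>) \<subseteq> ideal_colon R \<aa> \<mm>"
      unfolding colon_condition_def K[THEN conjunct1] by (elim allE[of _ \<aa>] conjE mp)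
  qed
  show ?thesis
    unfolding no_parameters colon_iff
    by (intro conjI trace_iff_colon trace_iff_sum[symmetric])
qed

end
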